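(* Let $\mathfrak{h}$ be a real $3$-step nilpotent Lie algebra whose center $\mathrm{Z}(\mathfrak{h})$ satisfies $\dim \mathrm{Z}(\mathfrak{h})=1$. Let $\langle\;,\;\rangle$ be a Lorentzian inner product on $\mathfrak{h}$ such that $\mathrm{Z}(\mathfrak{h})$ is non-degenerate. Then $(\mathfrak{h},\langle\;,\;\rangle)$ is Einstein if and only if it is Ricci-flat and one of the following holds: (i) $\dim\mathfrak{h}=6$ and there exist a basis $(f_1,\dots,f_6)$ of $\mathfrak{h}$ and a real number $\alpha\neq 0$ such that the only non-vanishing Lie brackets of basis vectors (up to antisymmetry) are $[f_1,f_2]=f_4,\ [f_1,f_3]=f_5,\ [f_2,f_4]=f_6,\ [f_3,f_5]=-f_6$ (so $\mathfrak{h}$ is isomorphic to the Lie algebra $\mathrm{L}_{6,19}(-1)$), and the metric is $\langle\;,\;\rangle=f_1^*\otimes f_1^*+2f_2^*\otimes f_2^*+2f_3^*\otimes f_3^*+4\alpha^4f_6^*\otimes f_6^*-2\alpha^2 f_4^*\odot f_5^*$; (ii) $\dim\mathfrak{h}=7$ and there exist a basis $(f_1,\dots,f_7)$ of $\mathfrak{h}$ and real numbers $0<r<1$, $a>0$ such that the only non-vanishing Lie brackets of basis vectors (up to antisymmetry) are $[f_1,f_2]=f_5,\ [f_1,f_3]=f_6,\ [f_2,f_3]=f_4,\ [f_6,f_2]=(1-r)f_7,\ [f_5,f_3]=-rf_7,\ [f_4,f_1]=f_7,$ and the metric is $\langle\;,\;\rangle=f_1^*\otimes f_1^*+f_2^*\otimes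 f_2^*+f_3^*\otimes f_3^*-a f_4^*\otimes f_4^*+ar f_5^*\otimes f_5^*+a(1-r)f_6^*\otimes f_6^*+a^2 f_7^*\otimes f_7^*$.
   Context: A Lorentzian inner product is a nondegenerate symmetric bilinear form of signature $(1,n-1)$ (one negative direction). A subspace is non-degenerate if the restriction of the form to it is nondegenerate. For a Lie algebra with pseudo-Euclidean inner product, the Levi-Civita product $\mathrm{L}$ is defined by $2\langle \mathrm{L}_uv,w\rangle=\langle[u,v],w\rangle+\langle[w,u],v\rangle+\langle[w,v],u\rangle$, the curvature by $K(u,v)=\mathrm{L}_{[u,v]}-[\mathrm{L}_u,\mathrm{L}_v]$, the Ricci curvature by $\mathrm{ric}(u,v)=\mathrm{tr}(w\mapsto K(u,w)v)$ and the Ricci operator $\mathrm{Ric}$ by $\langle\mathrm{Ric}(u),v\rangle=\mathrm{ric}(u,v)$. The metric is Einstein if $\mathrm{Ric}=\lambda\,\mathrm{Id}$ for some constant $\lambda\in\mathbb{R}$, and Ricci-flat if $\mathrm{ric}=0$. $(f_i^* )$ denotes the dual basis of $(f_i)$, and $f_4^*\odot f_5^*=f_4^*\otimes f_5^*+f_5^*\otimes f_4^*$. *)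

theory Defs
  imports "HOL-Analysis.Analysis"
begin

text \<open>A finite-dimensional real Lie algebra is modelled as a type 'a of class euclidean_space
(only its real vector space structure is used; its built-in inner product is used solely to
compute traces via an orthonormal basis) together with a bracket B.\<close>

definition lie_algebra :: "('a::real_vector \<Rightarrow> 'a \<Rightarrow> 'a) \<Rightarrow> bool" where
  "lie_algebra B \<longleftrightarrow> bilinear B \<and> (\<forall>x. B x x = 0) \<and>
     (\<forall>x y z. B x (B y z) + B y (B z x) + B z (B x y) = 0)"

fun lcs :: "('a::real_vector \<Rightarrow> 'a \<Rightarrow> 'a) \<Rightarrow> nat \<Rightarrow> 'a set" where
  "lcs B 0 = UNIV"
| "lcs B (Suc k) = span {B x y | x y. y \<in> lcs B k}"

definition three_step_nilpotent :: "('a::real_vector \<Rightarrow> 'a \<Rightarrow> 'a) \<Rightarrow> bool" where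
  "three_step_nilpotent B \<longleftrightarrow> lcs B 3 = {0} \<and> lcs B 2 \<noteq> {0}"

definition center :: "('a::real_vector \<Rightarrow> 'a \<Rightarrow> 'a) \<Rightarrow> 'a set" where
  "center B = {z. \<forall>x. B z x = 0}"

definition nondegenerate :: "('a::real_vector \<Rightarrow> 'a \<Rightarrow> real) \<Rightarrow> bool" where
  "nondegenerate g \<longleftrightarrow> (\<forall>x. (\<forall>y. g x y = 0) \<longrightarrow> x = 0)"

definition lorentzian :: "('a::euclidean_space \<Rightarrow> 'a \<Rightarrow> real) \<Rightarrow> bool" where
  "lorentzian g \<longleftrightarrow> bilinear g \<and> (\<forall>x y. g x y = g y x) \<and> nondegenerate g \<and>
     (\<exists>e::nat \<Rightarrow> 'a. \<forall>i<DIM('a). \<forall>j<DIM('a).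
        g (e i) (e j) = (if i \<noteq> j then 0 else if i = 0 then -1 else 1))"

definition nondeg_subspace :: "('a::real_vector \<Rightarrow> 'a \<Rightarrow> real) \<Rightarrow> 'a set \<Rightarrow> bool" where
  "nondeg_subspace g V \<longleftrightarrow> (\<forall>z\<in>V. (\<forall>w\<in>V. g z w = 0) \<longrightarrow> z = 0)"

definition LC :: "('a::real_vector \<Rightarrow> 'a \<Rightarrow> 'a) \<Rightarrow> ('a \<Rightarrow> 'a \<Rightarrow> real) \<Rightarrow> 'a \<Rightarrow> 'a \<Rightarrow> 'a" where
  "LC B g u v = (THE x. \<forall>w. 2 * g x w = g (B u v) w + g (B w u) v + g (B w v) u)"

definition curv :: "('a::real_vector \<Rightarrow> 'a \<Rightarrow> 'a) \<Rightarrow> ('a \<Rightarrow> 'a \<Rightarrow> real) \<Rightarrow> 'a \<Rightarrow> 'a \<Rightarrow> 'a \<Rightarrow> 'a" where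
  "curv B g u v w = LC B g (B u v) w - (LC B g u (LC B g v w) - LC B g v (LC B g u w))"

definition trace_map :: "('a::euclidean_space \<Rightarrow> 'a) \<Rightarrow> real" where
  "trace_map f = (\<Sum>b\<in>Basis. f b \<bullet> b)"

definition ric :: "('a::euclidean_space \<Rightarrow> 'a \<Rightarrow> 'a) \<Rightarrow> ('a \<Rightarrow> 'a \<Rightarrow> real) \<Rightarrow> 'a \<Rightarrow> 'a \<Rightarrow> real" where
  "ric B g u v = trace_map (\<lambda>w. curv B g u w v)"

definition Ric :: "('a::euclidean_space \<Rightarrow> 'a \<Rightarrow> 'a) \<Rightarrow> ('a \<Rightarrow> 'a \<Rightarrow> real) \<Rightarrow> 'a \<Rightarrow> 'a" where
  "Ric B g u = (THE x. \<forall>v. g x v = ric B g u v)"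

definition einstein :: "('a::euclidean_space \<Rightarrow> 'a \<Rightarrow> 'a) \<Rightarrow> ('a \<Rightarrow> 'a \<Rightarrow> real) \<Rightarrow> bool" where
  "einstein B g \<longleftrightarrow> (\<exists>c::real. \<forall>u. Ric B g u = c *\<^sub>R u)"

definition ricci_flat :: "('a::euclidean_space \<Rightarrow> 'a \<Rightarrow> 'a) \<Rightarrow> ('a \<Rightarrow> 'a \<Rightarrow> real) \<Rightarrow> bool" where
  "ricci_flat B g \<longleftrightarrow> (\<forall>u v. ric B g u v = 0)"

definition is_basis_n :: "nat \<Rightarrow> (nat \<Rightarrow> 'a::real_vector) \<Rightarrow> bool" where
  "is_basis_n n f \<longleftrightarrow> inj_on f {1..n} \<and> independent (f ` {1..n}) \<and> span (f ` {1..n}) = UNIV"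

definition br6 :: "(nat \<Rightarrow> 'a::real_vector) \<Rightarrow> nat \<Rightarrow> nat \<Rightarrow> 'a" where
  "br6 f i j =
    (if (i,j) = (1,2) then f 4 else if (i,j) = (2,1) then - f 4
     else if (i,j) = (1,3) then f 5 else if (i,j) = (3,1) then - f 5
     else if (i,j) = (2,4) then f 6 else if (i,j) = (4,2) then - f 6
     else if (i,j) = (3,5) then - f 6 else if (i,j) = (5,3) then f 6
     else 0)"

definition met6 :: "real \<Rightarrow> nat \<Rightarrow> nat \<Rightarrow> real" where
  "met6 \<alpha> i j =
    (if (i,j) = (1,1) then 1 else if (i,j) = (2,2) then 2 else if (i,j) = (3,3) then 2
     else if (i,j) = (6,6) then 4 * \<alpha>^4
     else if (i,j) = (4,5) \<or> (i,j) = (5,4) then - 2 * \<alpha>^2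
     else 0)"

definition br7 :: "real \<Rightarrow> (nat \<Rightarrow> 'a::real_vector) \<Rightarrow> nat \<Rightarrow> nat \<Rightarrow> 'a" where
  "br7 r f i j =
    (if (i,j) = (1,2) then f 5 else if (i,j) = (2,1) then - f 5
     else if (i,j) = (1,3) then f 6 else if (i,j) = (3,1) then - f 6
     else if (i,j) = (2,3) then f 4 else if (i,j) = (3,2) then - f 4
     else if (i,j) = (6,2) then (1 - r) *\<^sub>R f 7 else if (i,j) = (2,6) then - ((1 - r) *\<^sub>R f 7)
     else if (i,j) = (5,3) then - (r *\<^sub>R f 7) else if (i,j) = (3,5) then r *\<^sub>R f 7
     else if (i,j) = (4,1) then f 7 else if (i,j) = (1,4) then - f 7
     else 0)"

definition met7 :: "real \<Rightarrow> real \<Rightarrow> nat \<Rightarrow> nat \<Rightarrow> real" where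
  "met7 r a i j =
    (if i \<noteq> j then 0
     else if i = 1 \<or> i = 2 \<or> i = 3 then 1
     else if i = 4 then - a else if i = 5 then a * r else if i = 6 then a * (1 - r)
     else if i = 7 then a^2 else 0)"

end

theory Submission
  imports Defs
begin

text \<open>Normalise a generator \<open>z\<close> of the center to \<open>\<langle>z, z\<rangle> = 1 or -1\<close>. On \<open>V = z\<^sup>\<bottom>\<close> the bracket is
  \<open>[x, y] = N x y + \<zeta> \<langle>J x, y\<rangle> z\<close> with \<open>N\<close> two-step nilpotent and \<open>J\<close> skew, and the Einstein equations
  become equations for \<open>N\<close> and \<open>J\<close>. Let \<open>D\<close> be the span of the values of \<open>N\<close>. Sign considerations
  show that \<open>z\<close> is spacelike and that \<open>D\<close> is neither degenerate nor positive definite, so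
  \<open>E = V \<inter> D\<^sup>\<bottom>\<close> is Euclidean.

  Choose a basis of \<open>D\<close> which is orthogonal for the metric and for which the vectors \<open>J d\<close> are
  orthonormal, and let \<open>d0\<close> be its timelike member. Adding the diagonal Einstein equations with weight
  \<open>-2\<close> on \<open>d0\<close> and \<open>J d0\<close> and weight \<open>1\<close> on all other vectors produces a sum of nonnegative
  terms which is nonpositive. Hence the Einstein constant and almost all structure constants vanish.
  The others amount to a 2-form on the complement of \<open>J d0\<close> in \<open>E\<close> which, by the cocycle
  identity, is a convex combination of decomposable forms of no larger norm. Therefore it equals each
  of them, this complement is a plane, and \<open>dim D \<le> 3\<close>.\<close>

section \<open>Simultaneous diagonalisation and traces\<close>

text \<open>The obstacle is indefiniteness: the equations on \<open>E\<close> mix squares of both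
  signs. The weights come from the following balance. The square of \<open>g (N x y) d\<close>,
  divided by \<open>g d d\<close>, enters the equations at \<open>d\<close>, \<open>x\<close> and
  \<open>y\<close>, so its coefficient is a sum of three weights. Giving \<open>J d\<close> the
  weight of \<open>d\<close> cancels the terms with \<open>J\<close> on \<open>D\<close> against
  those on \<open>J D\<close>. For \<open>d0\<close> the quotient is nonpositive, so the coefficient
  must be nonpositive even if \<open>x\<close> and \<open>y\<close> have weight 1: the weight is at
  most -2. For any other \<open>d\<close> the coefficient must be nonnegative even if
  \<open>x\<close> is \<open>J d0\<close>: the weight is at least -2. (\<open>x\<close> and
  \<open>y\<close> cannot both be \<open>J d0\<close>, since \<open>N\<close> is alternating.) With
  -2 the coefficient vanishes exactly on the constants that survive: \<open>g (N x y) d0\<close>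
  with \<open>x\<close>, \<open>y\<close> orthogonal to \<open>J d0\<close>, and
  \<open>g (N (J d0) y) d\<close> with \<open>d\<close> different from \<open>d0\<close>. The
  equations with Einstein constant 0 normalise both kinds, and the cocycle identity at
  \<open>J d0\<close> relates them. The end is strict convexity of a ball: a boundary point that is
  a convex combination of points of the ball equals each of them.\<close>

lemma bilinear_diag_continuous:
  fixes p :: "'a::euclidean_space \<Rightarrow> 'a \<Rightarrow> real"
  assumes "bilinear p"
  shows "continuous_on A (\<lambda>x. p x x)"
proof -
  have "bounded_bilinear p"
    using assms bilinear_conv_bounded_bilinear by blast
  then show ?thesis
    by (rule bounded_bilinear.continuous_on) (rule continuous_on_id)+
qed

text \<open>Along \<open>y + s *\<^sub>R x\<close> the form is affine in \<open>s\<close>, because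
  its quadratic coefficient \<open>r x x\<close> is 0. If \<open>r x y\<close> were nonzero, the
  chosen \<open>s\<close> would give the value -1.\<close>

lemma nonneg_form_radical:
  fixes r :: "'a::real_vector \<Rightarrow> 'a \<Rightarrow> real"
  assumes r: "bilinear r" "\<And>x y. r x y = r y x"
    and W: "subspace W" "\<forall>x\<in>W. 0 \<le> r x x"
    and x: "x \<in> W" "r x x = 0" and y: "y \<in> W"
  shows "r x y = 0"
proof (rule ccontr)
  assume n: "r x y \<noteq> 0"
  define s where "s = - (r y y + 1) / (2 * r x y)"
  have "0 \<le> r (y + s *\<^sub>R x) (y + s *\<^sub>R x)"
    by (intro W(2)[rule_format] subspace_add subspace_mul W(1) x(1) y)
  also have "\<dots> = r y y + 2 * s * r x y"
    using x r(2)[of y x]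
    by (simp add: bilinear_ladd[OF r(1)] bilinear_radd[OF r(1)] bilinear_lmul[OF r(1)] bilinear_rmul[OF r(1)])
  also have "\<dots> = -1" using n by (simp add: s_def field_simps)
  finally show False by simp
qed

text \<open>Induction on the dimension, splitting off a maximiser of the Rayleigh quotient
  \<open>q x x / p x x\<close>. Definiteness is asked of \<open>p\<close> alone, so the Lorentzian
  metric can later take the place of \<open>q\<close>.\<close>

lemma simultaneous_diagonalization:
  fixes p q :: "'a::euclidean_space \<Rightarrow> 'a \<Rightarrow> real"
  assumes p: "bilinear p" "\<And>x y. p x y = p y x"
    and q: "bilinear q" "\<And>x y. q x y = q y x"
    and "subspace W" and "\<forall>x\<in>W. x \<noteq> 0 \<longrightarrow> 0 < p x x"
  shows "\<exists>S. finite S \<and> S \<subseteq> W \<and> (\<forall>b\<in>S. \<forall>c\<in>S. p b c = (if b = c then 1 else 0)) \<and>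
    (\<forall>b\<in>S. \<forall>c\<in>S. b \<noteq> c \<longrightarrow> q b c = 0) \<and> (\<forall>x\<in>W. x = (\<Sum>b\<in>S. p x b *\<^sub>R b))"
  using assms(5,6)
proof (induction "dim W" arbitrary: W rule: less_induct)
  case less
  note W = less.prems(1) and pos = less.prems(2)
  show ?case
  proof (cases "W \<subseteq> {0}")
    case True
    then show ?thesis by (intro exI[of _ "{}"]) auto
  next
    case False
    define K where "K = W \<inter> sphere 0 1"
    obtain w where w: "w \<in> W" "w \<noteq> 0" using False by auto
    have "w /\<^sub>R norm w \<in> K" using w W by (auto simp: K_def subspace_mul)
    then have K0: "K \<noteq> {}" by auto
    have Kc: "compact K" unfolding K_def
      using closed_subspace[OF W] by (simp add: closed_Int_compact)
    have Kp: "0 < p x x" if "x \<in> K" for x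
      using that bspec[OF pos, of x] by (force simp: K_def)
    have "continuous_on K (\<lambda>x. q x x / p x x)"
      using Kp by (intro continuous_on_divide bilinear_diag_continuous p q) (auto simp: less_le)
    from continuous_attains_sup[OF Kc K0 this] obtain x0 where
      x0: "x0 \<in> K" "\<And>y. y \<in> K \<Longrightarrow> q y y / p y y \<le> q x0 x0 / p x0 x0" by blast
    define m where "m = q x0 x0 / p x0 x0"
    \<comment> \<open>This form is semidefinite and vanishes at the maximiser, so \<open>x0\<close>
      lies in its radical: whatever is \<open>p\<close>-orthogonal to \<open>x0\<close> is also
      \<open>q\<close>-orthogonal to it.\<close>
    define r where "r = (\<lambda>x y. m * p x y - q x y)"
    have rb: "bilinear r" using p(1) q(1)
      unfolding bilinear_def r_def linear_iff by (simp add: algebra_simps)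
    have rs: "r x y = r y x" for x y using p(2) q(2) unfolding r_def by metis
    have x0W: "x0 \<in> W" "x0 \<noteq> 0" using x0(1) by (auto simp: K_def)
    have px0: "0 < p x0 x0" using pos x0W by auto
    have rpos: "0 \<le> r y y" if y: "y \<in> W" for y
    proof (cases "y = 0")
      case True then show ?thesis by (simp add: bilinear_lzero[OF rb])
    next
      case False
      let ?u = "y /\<^sub>R norm y"
      have u: "?u \<in> K" using y False W by (auto simp: K_def subspace_mul)
      have "q ?u ?u \<le> m * p ?u ?u"
        using x0(2)[OF u] Kp[OF u] by (simp add: m_def field_simps)
      then have "0 \<le> r ?u ?u" by (simp add: r_def)
      also have "r ?u ?u = r y y / (norm y)\<^sup>2"
        by (simp add: bilinear_lmul[OF rb] bilinear_rmul[OF rb] power2_eq_square divide_simps)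
      finally show ?thesis using False by (simp add: zero_le_divide_iff)
    qed
    have r0: "r x0 x0 = 0" using px0 by (simp add: r_def m_def)
    have key: "q x0 y = 0" if "y \<in> W" "p x0 y = 0" for y
      using nonneg_form_radical[OF rb rs W _ x0W(1) r0 that(1)] rpos that(2) by (simp add: r_def)
    define W' where "W' = {y \<in> W. p x0 y = 0}"
    have W': "subspace W'" unfolding W'_def subspace_def
      using W by (auto simp: subspace_def bilinear_radd[OF p(1)] bilinear_rmul[OF p(1)] bilinear_rzero[OF p(1)])
    have "x0 \<notin> W'" using px0 by (simp add: W'_def)
    then have "W' \<subset> W" using x0W by (auto simp: W'_def)
    then have "dim W' < dim W"
      using W W' by (metis dim_psubset span_eq_iff)
    have posW': "\<forall>x\<in>W'. x \<noteq> 0 \<longrightarrow> 0 < p x x" using pos by (simp add: W'_def)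
    obtain S' where
      S': "finite S'" "S' \<subseteq> W'" "\<forall>b\<in>S'. \<forall>c\<in>S'. p b c = (if b = c then 1 else 0)"
      "\<forall>b\<in>S'. \<forall>c\<in>S'. b \<noteq> c \<longrightarrow> q b c = 0" "\<forall>x\<in>W'. x = (\<Sum>b\<in>S'. p x b *\<^sub>R b)"
      using less.hyps[OF \<open>dim W' < dim W\<close> W' posW'] by (elim exE conjE)
    define x1 where "x1 = x0 /\<^sub>R sqrt (p x0 x0)"
    have x1W: "x1 \<in> W" using x0W W by (simp add: x1_def subspace_mul)
    have p1: "p x1 x1 = 1" using px0
      by (simp add: x1_def bilinear_lmul[OF p(1)] bilinear_rmul[OF p(1)] divide_simps)
    have o: "p x1 b = 0" "p b x1 = 0" "q x1 b = 0" "q b x1 = 0" if "b \<in> S'" for b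
    proof -
      have b: "b \<in> W" "p x0 b = 0" using that S'(2) by (auto simp: W'_def)
      show "p x1 b = 0" "q x1 b = 0" using b key[OF b]
        by (simp_all add: x1_def bilinear_lmul[OF p(1)] bilinear_lmul[OF q(1)])
      then show "p b x1 = 0" "q b x1 = 0" using p(2) q(2) by metis+
    qed
    have n1: "x1 \<notin> S'" using o p1 by force
    have ex: "x = (\<Sum>b\<in>insert x1 S'. p x b *\<^sub>R b)" if "x \<in> W" for x
    proof -
      define y where "y = x - p x x1 *\<^sub>R x1"
      have "p x1 y = 0" using p1 p(2)[of x1 x]
        by (simp add: y_def bilinear_rsub[OF p(1)] bilinear_rmul[OF p(1)])
      then have "p x0 y = 0" using px0 by (simp add: x1_def bilinear_lmul[OF p(1)])
      moreover have "y \<in> W" using that W x1W by (simp add: y_def subspace_diff subspace_mul)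
      ultimately have "y \<in> W'" by (simp add: W'_def)
      then have "y = (\<Sum>b\<in>S'. p y b *\<^sub>R b)" by (rule bspec[OF S'(5)])
      also have "\<dots> = (\<Sum>b\<in>S'. p x b *\<^sub>R b)"
        by (rule sum.cong) (auto simp: y_def bilinear_lsub[OF p(1)] bilinear_lmul[OF p(1)] o)
      finally show ?thesis using n1 S'(1) by (simp add: y_def algebra_simps)
    qed
    show ?thesis
    proof (intro exI[of _ "insert x1 S'"] conjI)
      show "insert x1 S' \<subseteq> W" using S'(2) x1W by (auto simp: W'_def)
      show "\<forall>b\<in>insert x1 S'. \<forall>c\<in>insert x1 S'. p b c = (if b = c then 1 else 0)"
        using S'(3) p1 o n1 by auto
      show "\<forall>b\<in>insert x1 S'. \<forall>c\<in>insert x1 S'. b \<noteq> c \<longrightarrow> q b c = 0"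
        using S'(4) o by auto
      show "finite (insert x1 S')" using S'(1) by simp
      show "\<forall>x\<in>W. x = (\<Sum>b\<in>insert x1 S'. p x b *\<^sub>R b)" by (intro ballI ex)
    qed
  qed
qed

lemma orthonormal_basis_pos_def:
  fixes g :: "'a::euclidean_space \<Rightarrow> 'a \<Rightarrow> real"
  assumes g: "bilinear g" "\<And>x y. g x y = g y x"
    and "subspace W" and "\<forall>x\<in>W. x \<noteq> 0 \<longrightarrow> 0 < g x x"
  obtains S where "finite S" "S \<subseteq> W" "\<And>b c. b \<in> S \<Longrightarrow> c \<in> S \<Longrightarrow> g b c = (if b = c then 1 else 0)"
    "\<And>x. x \<in> W \<Longrightarrow> x = (\<Sum>b\<in>S. g x b *\<^sub>R b)"
proof -
  obtain S where S: "finite S" "S \<subseteq> W" "\<forall>b\<in>S. \<forall>c\<in>S. g b c = (if b = c then 1 else 0)"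
    "\<forall>x\<in>W. x = (\<Sum>b\<in>S. g x b *\<^sub>R b)"
    using simultaneous_diagonalization[OF g g assms(3,4)] by (elim exE conjE)
  show thesis
    by (rule that[OF S(1,2)]) (use S(3) in simp, rule bspec[OF S(4)])
qed

section \<open>Traces of maps that lower a flag\<close>

lemma trace_map_commute:
  fixes f h :: "'a::euclidean_space \<Rightarrow> 'a"
  assumes "linear f" "linear h"
  shows "trace_map (\<lambda>x. f (h x)) = trace_map (\<lambda>x. h (f x))"
proof -
  have *: "trace_map (\<lambda>x. f (h x)) = (\<Sum>b\<in>Basis. \<Sum>c\<in>Basis. (h b \<bullet> c) * (f c \<bullet> b))"
    if "linear f" "linear h" for f h :: "'a \<Rightarrow> 'a"
  proof -
    have "f (h b) \<bullet> b = (\<Sum>c\<in>Basis. (h b \<bullet> c) * (f c \<bullet> b))" for b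
    proof -
      have "f (h b) = f (\<Sum>c\<in>Basis. (h b \<bullet> c) *\<^sub>R c)" by (simp add: euclidean_representation)
      also have "\<dots> = (\<Sum>c\<in>Basis. (h b \<bullet> c) *\<^sub>R f c)"
        by (simp add: linear_sum[OF that(1)] linear_scale[OF that(1)])
      finally show ?thesis by (simp add: inner_sum_left)
    qed
    then show ?thesis by (simp add: trace_map_def)
  qed
  show ?thesis unfolding *[OF assms] *[OF assms(2,1)]
    by (subst sum.swap) (simp add: mult.commute)
qed

text \<open>A projection \<open>P\<close> onto \<open>W\<close> satisfies
  \<open>P (f x) = f x\<close>, and cyclicity of the trace moves it inside: only the values of
  \<open>f\<close> on \<open>W\<close> matter.\<close>

lemma trace_map_range:
  fixes f :: "'a::euclidean_space \<Rightarrow> 'a"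
  assumes f: "linear f" and W: "subspace W" "\<And>x. f x \<in> W"
  obtains P where "linear P" "\<And>x. P x \<in> W" "\<And>x. x \<in> W \<Longrightarrow> P x = x"
    "trace_map f = trace_map (\<lambda>x. f (P x))"
proof -
  obtain P where P: "range P \<subseteq> W" "linear P" "\<And>x. x \<in> W \<Longrightarrow> P x = x"
    using linear_exists_left_inverse_on[OF linear_ident W(1)] by (auto simp: inj_on_def)
  have "trace_map f = trace_map (\<lambda>x. P (f x))" using P W by simp
  also have "\<dots> = trace_map (\<lambda>x. f (P x))" by (rule trace_map_commute[OF P(2) f])
  finally show ?thesis using that P by blast
qed

text \<open>Projecting first to \<open>W1\<close> and then to \<open>W2\<close> leaves the trace
  unchanged, and on \<open>W2\<close> the map is zero. The flag will be the lower central
  series.\<close>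

lemma trace_map_flag_zero:
  fixes f :: "'a::euclidean_space \<Rightarrow> 'a"
  assumes f: "linear f" and W: "subspace W1" "subspace W2"
    and "W2 \<subseteq> W1" and "\<And>x. f x \<in> W1" "\<And>x. x \<in> W1 \<Longrightarrow> f x \<in> W2" "\<And>x. x \<in> W2 \<Longrightarrow> f x = 0"
  shows "trace_map f = 0"
proof -
  obtain P where P: "linear P" "\<And>x. P x \<in> W1" "\<And>x. x \<in> W1 \<Longrightarrow> P x = x"
    "trace_map f = trace_map (\<lambda>x. f (P x))"
    using trace_map_range[OF f W(1) assms(5)] by metis
  have "linear (\<lambda>x. f (P x))" using linear_compose[OF P(1) f] by (simp add: o_def)
  from trace_map_range[OF this W(2)] assms(6) P(2) obtain Q where
    Q: "\<And>x. Q x \<in> W2" "trace_map (\<lambda>x. f (P x)) = trace_map (\<lambda>x. f (P (Q x)))" by metis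
  have "f (P (Q x)) = 0" for x using P(3) Q(1) assms(4,7) by (metis subsetD)
  then show ?thesis using P(4) Q(2) by (simp add: trace_map_def)
qed

section \<open>The Ricci curvature in an orthogonal frame\<close>

text \<open>Members are not normalised: dividing by \<open>g b b\<close> treats both signs alike,
  and the frame of \<open>D\<close> used later is normalised through \<open>J\<close> instead of
  \<open>g\<close>. The expansion clause makes the frame span \<open>W\<close> and excludes a
  radical of \<open>g\<close> on \<open>W\<close>.\<close>

definition orth_frame :: "('a::real_vector \<Rightarrow> 'a \<Rightarrow> real) \<Rightarrow> 'a set \<Rightarrow> 'a set \<Rightarrow> bool" where
  "orth_frame g W S \<longleftrightarrow> finite S \<and> S \<subseteq> W \<and> (\<forall>b\<in>S. g b b \<noteq> 0) \<and>
     (\<forall>b\<in>S. \<forall>c\<in>S. b \<noteq> c \<longrightarrow> g b c = 0) \<and> (\<forall>x\<in>W. x = (\<Sum>b\<in>S. (g x b / g b b) *\<^sub>R b))"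

lemma orth_frame_expand:
  assumes "orth_frame g W S" "x \<in> W"
  shows "x = (\<Sum>b\<in>S. (g x b / g b b) *\<^sub>R b)"
  using assms unfolding orth_frame_def by (elim conjE) (rule bspec)

lemma orth_frame_linear:
  fixes \<phi> :: "'a::real_vector \<Rightarrow> 'b::real_vector"
  assumes "orth_frame g W S" "x \<in> W" "linear \<phi>"
  shows "\<phi> x = (\<Sum>b\<in>S. (g x b / g b b) *\<^sub>R \<phi> b)"
  by (subst orth_frame_expand[OF assms(1,2)])
    (simp add: linear_sum[OF assms(3)] linear_scale[OF assms(3)])

locale symmetric_form =
  fixes g :: "'a::euclidean_space \<Rightarrow> 'a \<Rightarrow> real"
  assumes bilin: "bilinear g" and sym: "g x y = g y x"
begin

lemmas form_simps = bilinear_ladd[OF bilin] bilinear_radd[OF bilin] bilinear_lmul[OF bilin]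
  bilinear_rmul[OF bilin] bilinear_lneg[OF bilin] bilinear_rneg[OF bilin]
  bilinear_lsub[OF bilin] bilinear_rsub[OF bilin] bilinear_lzero[OF bilin] bilinear_rzero[OF bilin]

lemma linear_left: "linear (\<lambda>x. g x y)" and linear_right: "linear (g x)"
  using bilin by (auto simp: bilinear_def)

lemma sum_left: "g (\<Sum>i\<in>I. f i) y = (\<Sum>i\<in>I. g (f i) y)"
  by (rule linear_sum[OF linear_left])

lemma frame_form:
  assumes "orth_frame g W S" "x \<in> W"
  shows "g x y = (\<Sum>b\<in>S. g x b * g y b / g b b)"
  using orth_frame_linear[OF assms linear_left[of y]] by (simp add: sym[of y])

text \<open>The trace is basis independent, so the built-in orthonormal basis can be exchanged for a
  frame of \<open>g\<close>.\<close>

lemma trace_map_frame: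
  assumes S: "orth_frame g UNIV S" and f: "linear f"
  shows "trace_map f = (\<Sum>b\<in>S. g (f b) b / g b b)"
proof -
  have "trace_map f = (\<Sum>a\<in>Basis. \<Sum>b\<in>S. (g (f a) b / g b b) * (b \<bullet> a))"
    unfolding trace_map_def
  proof (rule sum.cong[OF refl])
    fix a :: 'a
    have "linear (\<lambda>y. y \<bullet> a)" by (simp add: linear_iff inner_add_left)
    from orth_frame_linear[OF S _ this, of "f a"]
    show "f a \<bullet> a = (\<Sum>b\<in>S. (g (f a) b / g b b) * (b \<bullet> a))" by simp
  qed
  also have "\<dots> = (\<Sum>b\<in>S. \<Sum>a\<in>Basis. (g (f a) b / g b b) * (b \<bullet> a))" by (rule sum.swap)
  also have "\<dots> = (\<Sum>b\<in>S. g (f b) b / g b b)"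
  proof (rule sum.cong[OF refl])
    fix b :: 'a
    have "f b = f (\<Sum>a\<in>Basis. (b \<bullet> a) *\<^sub>R a)" by (simp add: euclidean_representation)
    also have "\<dots> = (\<Sum>a\<in>Basis. (b \<bullet> a) *\<^sub>R f a)"
      by (simp add: linear_sum[OF f] linear_scale[OF f])
    finally have "g (f b) b = (\<Sum>a\<in>Basis. (b \<bullet> a) * g (f a) b)"
      by (simp add: sum_left form_simps)
    then show "(\<Sum>a\<in>Basis. (g (f a) b / g b b) * (b \<bullet> a)) = g (f b) b / g b b"
      by (simp add: sum_divide_distrib mult.commute)
  qed
  finally show ?thesis .
qed

lemma frame_ext:
  assumes "orth_frame g UNIV S" "\<And>w. g x w = g y w"
  shows "x = y"
proof -
  have "x = (\<Sum>b\<in>S. (g x b / g b b) *\<^sub>R b)" by (rule orth_frame_expand[OF assms(1)]) simp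
  also have "\<dots> = (\<Sum>b\<in>S. (g y b / g b b) *\<^sub>R b)" by (simp add: assms(2))
  also have "\<dots> = y" by (rule orth_frame_expand[OF assms(1), symmetric]) simp
  finally show ?thesis .
qed

lemma frame_riesz:
  assumes S: "orth_frame g UNIV S" and \<phi>: "linear \<phi>"
  shows "g (\<Sum>b\<in>S. (\<phi> b / g b b) *\<^sub>R b) w = \<phi> w"
  using orth_frame_linear[OF S _ \<phi>, of w] by (simp add: sum_left form_simps sym[of w] mult.commute)

text \<open>This gives meaning to the definite descriptions in \<open>LC\<close> and
  \<open>Ric\<close>: a frame provides existence and uniqueness of the representing vector.\<close>

lemma frame_THE:
  assumes S: "orth_frame g UNIV S" and \<phi>: "linear \<phi>"
  shows "g (THE x. \<forall>w. g x w = \<phi> w) w = \<phi> w"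
proof -
  have "\<exists>!x. \<forall>w. g x w = \<phi> w"
  proof (rule ex1I[of _ "\<Sum>b\<in>S. (\<phi> b / g b b) *\<^sub>R b"])
    show "\<forall>w. g (\<Sum>b\<in>S. (\<phi> b / g b b) *\<^sub>R b) w = \<phi> w" using frame_riesz[OF S \<phi>] by simp
    then show "x = (\<Sum>b\<in>S. (\<phi> b / g b b) *\<^sub>R b)" if "\<forall>w. g x w = \<phi> w" for x
      using that by (intro frame_ext[OF S]) simp
  qed
  from theI'[OF this] show ?thesis by simp
qed

end

section \<open>Levi-Civita product and Ricci curvature of a metric Lie algebra\<close>

locale metric_lie_algebra = symmetric_form g for g :: "'a::euclidean_space \<Rightarrow> 'a \<Rightarrow> real" +
  fixes B :: "'a \<Rightarrow> 'a \<Rightarrow> 'a" and S :: "'a set"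
  assumes lie: "lie_algebra B" and frame: "orth_frame g UNIV S"
begin

lemma B_bilin: "bilinear B" and B_self [simp]: "B x x = 0"
  and jacobi: "B x (B y z) + B y (B z x) + B z (B x y) = 0"
  using lie by (auto simp: lie_algebra_def)

lemmas B_simps = bilinear_ladd[OF B_bilin] bilinear_radd[OF B_bilin] bilinear_lmul[OF B_bilin]
  bilinear_rmul[OF B_bilin] bilinear_lneg[OF B_bilin] bilinear_rneg[OF B_bilin]
  bilinear_lsub[OF B_bilin] bilinear_rsub[OF B_bilin] bilinear_lzero[OF B_bilin] bilinear_rzero[OF B_bilin]

lemma B_linear_right: "linear (B x)"
  using B_bilin by (auto simp: bilinear_def)

lemma B_anti: "B x y = - B y x"
proof -
  have "B (x + y) (x + y) = B x x + B x y + (B y x + B y y)"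
    by (simp only: bilinear_ladd[OF B_bilin] bilinear_radd[OF B_bilin] add_ac)
  then show ?thesis by (simp add: eq_neg_iff_add_eq_0)
qed

abbreviation L where "L \<equiv> LC B g"

lemma LC_eq: "2 * g (L u v) w = g (B u v) w + g (B w u) v + g (B w v) u"
proof -
  define \<phi> where "\<phi> = (\<lambda>w. (g (B u v) w + g (B w u) v + g (B w v) u) / 2)"
  have "linear \<phi>" unfolding \<phi>_def linear_iff by (simp add: form_simps B_simps algebra_simps add_divide_distrib)
  from frame_THE[OF frame this, of w]
  have "g (THE x. \<forall>w. g x w = \<phi> w) w = \<phi> w" .
  moreover have "(\<forall>w. g x w = \<phi> w) = (\<forall>w. 2 * g x w = g (B u v) w + g (B w u) v + g (B w v) u)" for x
    unfolding \<phi>_def by (simp add: field_simps)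
  ultimately show ?thesis by (simp add: LC_def \<phi>_def)
qed

lemma LC_half: "g (L u v) w = (g (B u v) w + g (B w u) v + g (B w v) u) / 2"
  using LC_eq[of u v w] by simp

lemma LC_bilin: "bilinear L"
  unfolding bilinear_def linear_iff
  by (intro allI conjI frame_ext[OF frame])
    (simp_all add: LC_half form_simps B_simps add_divide_distrib algebra_simps)

lemmas LC_simps = bilinear_ladd[OF LC_bilin] bilinear_radd[OF LC_bilin] bilinear_lmul[OF LC_bilin]
  bilinear_rmul[OF LC_bilin]

lemma LC_skew: "g (L u v) w = - g (L u w) v"
proof -
  have "2 * g (L u v) w + 2 * g (L u w) v = 0"
    unfolding LC_eq using B_anti[of w u] B_anti[of v u] B_anti[of v w] by (simp add: form_simps sym)
  then show ?thesis by simp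
qed

lemma LC_torsion: "L u v = B u v + L v u"
  using B_anti[of v u]
  by (intro frame_ext[OF frame]) (simp add: LC_half form_simps field_simps)

end

text \<open>What nilpotency contributes to the Ricci curvature: the algebra is unimodular and its
  Killing form is zero.\<close>

locale nilpotent_metric_lie_algebra = metric_lie_algebra +
  assumes trace_ad: "trace_map (B x) = 0" and trace_ad_ad: "trace_map (\<lambda>z. B x (B y z)) = 0"
begin

lemma curv_linear: "linear (\<lambda>w. curv B g u w v)"
  unfolding curv_def linear_iff by (simp add: B_simps LC_simps algebra_simps)

lemma frame_ad: "(\<Sum>b\<in>S. g (B x b) b / g b b) = 0"
  using trace_map_frame[OF frame B_linear_right] trace_ad by simp

lemma frame_ad_ad: "(\<Sum>b\<in>S. g (B x (B y b)) b / g b b) = 0"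
  using trace_map_frame[OF frame, of "\<lambda>z. B x (B y z)"] trace_ad_ad
    linear_compose[OF B_linear_right B_linear_right] by (simp add: o_def)

text \<open>Up to sign, \<open>2 * g (L b v) c\<close> is the sum of a part symmetric in
  \<open>b\<close> and \<open>c\<close> and the antisymmetric part \<open>g (B b c) v\<close>. Mixed
  products cancel when \<open>b\<close> and \<open>c\<close> are exchanged; the two squares give the
  two sums on the right.\<close>

lemma frame_LC_LC:
  "(\<Sum>b\<in>S. g (L b v) (L b u) / g b b) = 1/2 * (\<Sum>b\<in>S. g (B u b) (B v b) / g b b) +
    1/4 * (\<Sum>b\<in>S. \<Sum>c\<in>S. g (B b c) u * g (B b c) v / (g b b * g c c))"
proof -
  let ?s = "\<lambda>v b c. g (B v b) c + g (B v c) b"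
  have e: "2 * g (L b v) c = - (?s v b c + g (B b c) v)" for b c v
    unfolding LC_eq using B_anti[of b v] B_anti[of c v] B_anti[of c b] by (simp add: form_simps)
  have 1: "g (L b v) (L b u) / g b b = (\<Sum>c\<in>S. (?s v b c + g (B b c) v) * (?s u b c + g (B b c) u) / (4 * g b b * g c c))" for b
  proof -
    have h: "g (L b v) c * g (L b u) c = (?s v b c + g (B b c) v) * (?s u b c + g (B b c) u) / 4" for c
      using e[of b v c] e[of b u c] by (simp add: field_simps) algebra
    have *: "g (L b v) c * g (L b u) c / (g b b * g c c) =
      (?s v b c + g (B b c) v) * (?s u b c + g (B b c) u) / (4 * g b b * g c c)" for c
      unfolding h by (simp add: mult.assoc)
    have "g (L b v) (L b u) / g b b = (\<Sum>c\<in>S. g (L b v) c * g (L b u) c / (g b b * g c c))"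
      by (subst frame_form[OF frame]) (simp_all add: sum_divide_distrib mult.commute)
    then show ?thesis unfolding * .
  qed
  let ?n = "\<lambda>b c. g b b * g c c"
  let ?SS = "\<lambda>f. \<Sum>b\<in>S. \<Sum>c\<in>S. f b c / ?n b c"
  have swap: "?SS f = ?SS (\<lambda>b c. f c b)" for f :: "'a \<Rightarrow> 'a \<Rightarrow> real"
    by (subst sum.swap) (simp add: mult.commute)
  have sq: "?SS (\<lambda>b c. g (B v b) c * g (B u b) c) = (\<Sum>b\<in>S. g (B u b) (B v b) / g b b)"
  proof (rule sum.cong[OF refl])
    fix b
    show "(\<Sum>c\<in>S. g (B v b) c * g (B u b) c / ?n b c) = g (B u b) (B v b) / g b b"
      by (subst frame_form[OF frame]) (simp_all add: sum_divide_distrib mult.commute)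
  qed
  \<comment> \<open>The double sum is the trace of \<open>B u\<close> composed with
    \<open>B v\<close>, that is, the Killing form.\<close>
  have cr: "?SS (\<lambda>b c. g (B v b) c * g (B u c) b) = 0"
  proof -
    have "(\<Sum>c\<in>S. g (B v b) c * g (B u c) b / ?n b c) = g (B u (B v b)) b / g b b" for b
    proof -
      have "linear (\<lambda>x. g (B u x) b)"
        using linear_compose[OF B_linear_right linear_left] by (simp add: o_def)
      from orth_frame_linear[OF frame _ this, of "B v b"]
      show ?thesis by (simp add: sum_divide_distrib divide_simps mult.commute)
    qed
    then show ?thesis using frame_ad_ad by simp
  qed
  have mixed: "?SS (\<lambda>b c. ?s v b c * g (B b c) u) = 0" for u v
  proof -
    have "?SS (\<lambda>b c. ?s v b c * g (B b c) u) = ?SS (\<lambda>b c. ?s v c b * g (B c b) u)"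
      by (rule swap)
    also have "\<dots> = - ?SS (\<lambda>b c. ?s v b c * g (B b c) u)"
      unfolding sum_negf[symmetric]
      by (intro sum.cong refl) (subst B_anti, simp add: form_simps add.commute)
    finally show ?thesis by simp
  qed
  have "(\<Sum>b\<in>S. g (L b v) (L b u) / g b b) = 1/4 * ?SS (\<lambda>b c. (?s v b c + g (B b c) v) * (?s u b c + g (B b c) u))"
    unfolding 1 by (simp add: sum_distrib_left mult.assoc)
  also have "?SS (\<lambda>b c. (?s v b c + g (B b c) v) * (?s u b c + g (B b c) u)) =
     ?SS (\<lambda>b c. g (B v b) c * g (B u b) c) + ?SS (\<lambda>b c. g (B v c) b * g (B u c) b)
     + ?SS (\<lambda>b c. g (B v b) c * g (B u c) b) + ?SS (\<lambda>b c. g (B v c) b * g (B u b) c)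
     + ?SS (\<lambda>b c. ?s v b c * g (B b c) u) + ?SS (\<lambda>b c. ?s u b c * g (B b c) v)
     + ?SS (\<lambda>b c. g (B b c) u * g (B b c) v)"
    by (simp add: sum.distrib[symmetric] add_divide_distrib[symmetric] algebra_simps)
  also have "?SS (\<lambda>b c. g (B v c) b * g (B u c) b) = ?SS (\<lambda>b c. g (B v b) c * g (B u b) c)"
    by (rule swap)
  also have "?SS (\<lambda>b c. g (B v c) b * g (B u b) c) = ?SS (\<lambda>b c. g (B v b) c * g (B u c) b)"
    by (rule swap)
  finally show ?thesis unfolding sq cr mixed by simp
qed

lemma ric_formula:
  "ric B g u v = - 1/2 * (\<Sum>b\<in>S. g (B u b) (B v b) / g b b) +
    1/4 * (\<Sum>b\<in>S. \<Sum>c\<in>S. g (B b c) u * g (B b c) v / (g b b * g c c))"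
proof -
  \<comment> \<open>Skewness and vanishing torsion of \<open>L\<close> express a diagonal curvature
    entry by one product of \<open>L\<close>-terms and three bracket terms; the last two sum to the
    traces that vanish.\<close>
  have p: "g (curv B g u b v) b = g (L b v) (L b u) - g (B u b) (B v b) - g (B v (B u b)) b
    - g (B (L u v) b) b" for b
  proof -
    have 1: "g (L (B u b) v) b + g (L b v) (B u b) = - g (B u b) (B v b) - g (B v (B u b)) b"
    proof -
      have "2 * g (L (B u b) v) b + 2 * g (L b v) (B u b) = - 2 * g (B u b) (B v b) - 2 * g (B v (B u b)) b"
        unfolding LC_eq using B_anti[of b v] B_anti[of "B u b" v] B_anti[of b "B u b"]
        by (simp add: form_simps sym)
      then show ?thesis by simp
    qed
    have 2: "g (L u (L b v)) b = - g (L b v) (B u b) - g (L b v) (L b u)"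
      using LC_skew[of u "L b v" b] LC_torsion[of u b] by (simp add: form_simps sym)
    have 3: "g (L b (L u v)) b = - g (B (L u v) b) b"
      using LC_eq[of b "L u v" b] B_anti[of b "L u v"] by (simp add: form_simps)
    show ?thesis using 1 2 3 by (simp add: curv_def form_simps)
  qed
  have "ric B g u v = (\<Sum>b\<in>S. g (L b v) (L b u) / g b b) - (\<Sum>b\<in>S. g (B u b) (B v b) / g b b)
     - (\<Sum>b\<in>S. g (B v (B u b)) b / g b b) - (\<Sum>b\<in>S. g (B (L u v) b) b / g b b)"
    unfolding ric_def trace_map_frame[OF frame curv_linear] p
    by (simp add: diff_divide_distrib sum_subtractf)
  then show ?thesis unfolding frame_ad frame_ad_ad frame_LC_LC by simp
qed

end

section \<open>Lorentzian forms and the reduction modulo the center\<close>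

context symmetric_form
begin

lemma orthogonal_span_expand:
  assumes S: "finite S" "\<forall>b\<in>S. g b b \<noteq> 0" "\<forall>b\<in>S. \<forall>c\<in>S. b \<noteq> c \<longrightarrow> g b c = 0"
    and x: "x \<in> span S"
  shows "x = (\<Sum>b\<in>S. (g x b / g b b) *\<^sub>R b)"
proof -
  obtain u where u: "x = (\<Sum>b\<in>S. u b *\<^sub>R b)" using x span_finite[OF S(1)] by auto
  have "g x b / g b b = u b" if b: "b \<in> S" for b
  proof -
    have "g x b = (\<Sum>c\<in>S. u c * g c b)" by (simp add: u sum_left form_simps)
    also have "\<dots> = (\<Sum>c\<in>S. if c = b then u b * g b b else 0)"
      using S(3) b by (intro sum.cong) auto
    also have "\<dots> = u b * g b b" using S(1) b by simp
    finally show ?thesis using S(2) b by simp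
  qed
  then have "(\<Sum>b\<in>S. (g x b / g b b) *\<^sub>R b) = (\<Sum>b\<in>S. u b *\<^sub>R b)" by (intro sum.cong) auto
  then show ?thesis using u by simp
qed

lemma orthogonal_independent:
  assumes S: "finite S" "\<forall>b\<in>S. g b b \<noteq> 0" "\<forall>b\<in>S. \<forall>c\<in>S. b \<noteq> c \<longrightarrow> g b c = 0"
  shows "independent S"
proof (rule independent_if_scalars_zero[OF S(1)])
  fix u b assume 0: "(\<Sum>x\<in>S. u x *\<^sub>R x) = 0" and b: "b \<in> S"
  have "0 = g (\<Sum>x\<in>S. u x *\<^sub>R x) b" by (simp add: 0 form_simps)
  also have "\<dots> = (\<Sum>c\<in>S. u c * g c b)" by (simp add: sum_left form_simps)
  also have "\<dots> = (\<Sum>c\<in>S. if c = b then u b * g b b else 0)"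
    using S(3) b by (intro sum.cong) auto
  also have "\<dots> = u b * g b b" using S(1) b by simp
  finally show "u b = 0" using S(2) b by simp
qed

lemma orth_frame_insert:
  assumes z: "g z z \<noteq> 0" "z \<in> W" and S: "orth_frame g {x \<in> W. g x z = 0} S" and W: "subspace W"
  shows "orth_frame g W (insert z S)" and "z \<notin> S"
proof -
  have S': "finite S" "S \<subseteq> {x \<in> W. g x z = 0}" "\<forall>b\<in>S. g b b \<noteq> 0" "\<forall>b\<in>S. \<forall>c\<in>S. b \<noteq> c \<longrightarrow> g b c = 0"
    using S by (auto simp: orth_frame_def)
  have o: "g b z = 0" "g z b = 0" if "b \<in> S" for b using that S'(2) sym[of z b] by auto
  show zn: "z \<notin> S" using o z by auto
  have "x = (\<Sum>b\<in>insert z S. (g x b / g b b) *\<^sub>R b)" if x: "x \<in> W" for x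
  proof -
    define y where "y = x - (g x z / g z z) *\<^sub>R z"
    have "y \<in> {x \<in> W. g x z = 0}" using x z W by (simp add: y_def form_simps subspace_diff subspace_mul)
    then have "y = (\<Sum>b\<in>S. (g y b / g b b) *\<^sub>R b)" by (rule orth_frame_expand[OF S])
    also have "\<dots> = (\<Sum>b\<in>S. (g x b / g b b) *\<^sub>R b)"
      by (rule sum.cong) (simp_all add: y_def form_simps o)
    finally show ?thesis using zn S'(1) by (simp add: y_def algebra_simps)
  qed
  then show "orth_frame g W (insert z S)" unfolding orth_frame_def
    using S' z o by (intro conjI ballI) auto
qed

lemma pos_def_frame:
  assumes "subspace W" "\<forall>x\<in>W. x \<noteq> 0 \<longrightarrow> 0 < g x x"
  obtains S where "orth_frame g W S" "\<And>b. b \<in> S \<Longrightarrow> g b b = 1"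
proof -
  obtain S where S: "finite S" "S \<subseteq> W" "\<And>b c. b \<in> S \<Longrightarrow> c \<in> S \<Longrightarrow> g b c = (if b = c then 1 else 0)"
    "\<And>x. x \<in> W \<Longrightarrow> x = (\<Sum>b\<in>S. g x b *\<^sub>R b)"
    using orthonormal_basis_pos_def[OF bilin sym assms] by metis
  have "x = (\<Sum>b\<in>S. (g x b / g b b) *\<^sub>R b)" if "x \<in> W" for x
  proof -
    have "(\<Sum>b\<in>S. (g x b / g b b) *\<^sub>R b) = (\<Sum>b\<in>S. g x b *\<^sub>R b)" using S(3) by (intro sum.cong) auto
    then show ?thesis using S(4)[OF that] by simp
  qed
  then have "orth_frame g W S" unfolding orth_frame_def using S(1-3) by simp
  then show thesis using that S(3) by simp
qed

lemma subspace_orth: "subspace {x. g x z = 0}"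
  by (simp add: subspace_def form_simps)

lemma frame_sq:
  assumes "orth_frame g W S" "x \<in> W"
  shows "g x x = (\<Sum>b\<in>S. (g x b)\<^sup>2 / g b b)"
  using frame_form[OF assms, of x] by (simp add: power2_eq_square)

end

text \<open>The signature is recorded by a single timelike vector with positive definite complement.
  \<open>timelike_orth\<close> carries this over to every timelike vector, and all later sign
  arguments go through orthogonality to one.\<close>

locale lorentzian_form = symmetric_form +
  assumes timelike_ref: "\<exists>t. g t t < 0 \<and> (\<forall>x. g x t = 0 \<longrightarrow> x \<noteq> 0 \<longrightarrow> 0 < g x x)"
begin

lemma timelike_orth:
  assumes t: "g t t < 0" "g x t = 0" "x \<noteq> 0"
  shows "0 < g x x"
proof (rule ccontr)
  assume neg: "\<not> 0 < g x x"
  obtain t0 where t0: "g t0 t0 < 0" "\<And>x. g x t0 = 0 \<Longrightarrow> x \<noteq> 0 \<Longrightarrow> 0 < g x x"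
    using timelike_ref by blast
  have n: "g t t0 \<noteq> 0" using t0(2)[of t] t(1) by (cases "t = 0") (auto simp: form_simps)
  \<comment> \<open>The combination of \<open>x\<close> and \<open>t\<close> orthogonal to
    \<open>t0\<close>. As \<open>g\<close> would be nonpositive on the plane of \<open>x\<close> and
    \<open>t\<close>, it must vanish, and pairing it with \<open>t\<close> then forces
    \<open>x = 0\<close>.\<close>
  define y where "y = g t t0 *\<^sub>R x - g x t0 *\<^sub>R t"
  have "g y y = (g t t0)\<^sup>2 * g x x + (g x t0)\<^sup>2 * g t t"
    using t(2) sym[of t x] by (simp add: y_def form_simps power2_eq_square algebra_simps)
  also have "\<dots> \<le> 0" using neg t(1) by (intro add_nonpos_nonpos mult_nonneg_nonpos) auto
  finally have "g y y \<le> 0" .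
  moreover have "g y t0 = 0" by (simp add: y_def form_simps)
  ultimately have "y = 0" using t0(2)[of y] by force
  then have "g y t = 0" by (simp add: form_simps)
  then have "g x t0 = 0" using t by (simp add: y_def form_simps)
  then show False using \<open>y = 0\<close> n t(3) by (simp add: y_def)
qed

lemma timelike_orth_nonneg:
  assumes "g t t < 0" "g x t = 0" shows "0 \<le> g x x"
  using timelike_orth[OF assms] by (cases "x = 0") (auto simp: form_simps)

lemma timelike_orth_zero:
  assumes "g t t < 0" "g x t = 0" "g x x \<le> 0" shows "x = 0"
  using timelike_orth[OF assms(1,2)] assms(3) by force

lemma null_orth_nonneg:
  assumes "g n n = 0" "n \<noteq> 0" "g x n = 0" shows "0 \<le> g x x"
  using timelike_orth[of x n] assms sym[of n x] by force

text \<open>Subtracting a multiple of \<open>n\<close> does not change the norm of \<open>x\<close>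
  and can make it orthogonal to a timelike vector, where a nonpositive norm means zero.\<close>

lemma null_orth_multiple:
  assumes n: "g n n = 0" "n \<noteq> 0" and x: "g x n = 0" "g x x \<le> 0"
  shows "\<exists>c. x = c *\<^sub>R n"
proof -
  obtain t0 where t0: "g t0 t0 < 0" using timelike_ref by blast
  have nt: "g n t0 \<noteq> 0" using timelike_orth[OF t0, of n] n by auto
  define y where "y = x - (g x t0 / g n t0) *\<^sub>R n"
  have "g y t0 = 0" using nt by (simp add: y_def form_simps)
  moreover have "g y y = g x x" using n x sym[of n x] by (simp add: y_def form_simps)
  ultimately have "y = 0" using timelike_orth_zero[OF t0] x by simp
  then show ?thesis by (auto simp: y_def)
qed

end

lemma lorentzian_frame:
  fixes g :: "'a::euclidean_space \<Rightarrow> 'a \<Rightarrow> real"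
  assumes "lorentzian g"
  shows "\<exists>S. orth_frame g UNIV S" and "lorentzian_form g"
proof -
  from assms interpret symmetric_form g by unfold_locales (auto simp: lorentzian_def)
  obtain e :: "nat \<Rightarrow> 'a" where e: "\<And>i j. i < DIM('a) \<Longrightarrow> j < DIM('a) \<Longrightarrow>
      g (e i) (e j) = (if i \<noteq> j then 0 else if i = 0 then -1 else 1)"
    using assms unfolding lorentzian_def by metis
  define S where "S = e ` {..<DIM('a)}"
  have inj: "inj_on e {..<DIM('a)}"
  proof (rule inj_onI)
    fix i j assume ij: "i \<in> {..<DIM('a)}" "j \<in> {..<DIM('a)}" "e i = e j"
    show "i = j"
    proof (rule ccontr)
      assume "i \<noteq> j"
      then have "g (e i) (e j) = 0" using e[of i j] ij by simp
      then have "g (e i) (e i) = 0" using ij by simp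
      then show False using e[of i i] ij(1) by (simp split: if_splits)
    qed
  qed
  have S: "finite S" "\<forall>b\<in>S. g b b \<noteq> 0" "\<forall>b\<in>S. \<forall>c\<in>S. b \<noteq> c \<longrightarrow> g b c = 0"
    by (auto simp: S_def e)
  have "card S = DIM('a)" using inj by (simp add: S_def card_image)
  then have "span S = UNIV"
    using card_ge_dim_independent[of S UNIV] orthogonal_independent[OF S] by (auto simp: dim_UNIV)
  then have fr: "orth_frame g UNIV S" unfolding orth_frame_def
    using S orthogonal_span_expand[OF S] by auto
  then show "\<exists>S. orth_frame g UNIV S" by blast
  have "g (e 0) (e 0) < 0" using e[of 0 0] by simp
  moreover have "0 < g x x" if x: "g x (e 0) = 0" "x \<noteq> 0" for x
  proof -
    have nn: "0 \<le> (g x b)\<^sup>2 / g b b" if b: "b \<in> S" for b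
    proof -
      obtain i where i: "b = e i" "i < DIM('a)" using b by (auto simp: S_def)
      show ?thesis using x(1) e[OF i(2,2)] by (cases "i = 0") (auto simp: i(1))
    qed
    have "g x x \<noteq> 0"
    proof
      assume "g x x = 0"
      then have "\<forall>b\<in>S. (g x b)\<^sup>2 / g b b = 0"
        using frame_sq[OF fr, of x] sum_nonneg_eq_0_iff[OF S(1) nn] by simp
      then have 0: "\<forall>b\<in>S. g x b = 0" using S(2) by simp
      have "x = (\<Sum>b\<in>S. (g x b / g b b) *\<^sub>R b)" by (rule orth_frame_expand[OF fr]) simp
      also have "\<dots> = 0" using 0 by simp
      finally show False using x(2) by simp
    qed
    moreover have "0 \<le> g x x" using frame_sq[OF fr, of x] sum_nonneg[of S, OF nn] by simp
    ultimately show ?thesis by simp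
  qed
  ultimately show "lorentzian_form g" by unfold_locales blast
qed

text \<open>\<open>N\<close> is the bracket modulo the center and the skew \<open>J\<close> encodes
  its central component. \<open>cocycle\<close> is the \<open>z\<close>-component of the Jacobi
  identity, \<open>N_N\<close> reflects three-step nilpotency, and \<open>center_zero\<close> says
  that the center is just the line of \<open>z\<close>. The last two assumptions are the Einstein
  equations on \<open>V\<close> and at \<open>(z, z)\<close>, stated for every frame so that the
  frame can be chosen afterwards.\<close>

locale einstein_reduction = lorentzian_form g for g :: "'a::euclidean_space \<Rightarrow> 'a \<Rightarrow> real" +
  fixes z :: 'a and N :: "'a \<Rightarrow> 'a \<Rightarrow> 'a" and J :: "'a \<Rightarrow> 'a" and \<zeta> lam :: real
  assumes gzz: "g z z = \<zeta>" and zeta: "\<zeta> = 1 \<or> \<zeta> = - 1"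
    and N_bilin: "bilinear N" and N_self [simp]: "N x x = 0"
    and N_V [simp]: "g (N x y) z = 0" and N_z [simp]: "N z x = 0"
    and J_linear: "linear J" and J_skew: "g (J x) y = - g x (J y)" and J_z [simp]: "J z = 0"
    and N_N [simp]: "N (N x y) w = 0"
    and cocycle: "g (J (N x y)) w + g (J (N y w)) x + g (J (N w x)) y = 0"
    and N_nontrivial: "\<exists>x y. N x y \<noteq> 0"
    and center_zero: "g x z = 0 \<Longrightarrow> (\<And>y. N x y = 0) \<Longrightarrow> J x = 0 \<Longrightarrow> x = 0"
    and einstein_V: "orth_frame g {x. g x z = 0} S \<Longrightarrow> g u z = 0 \<Longrightarrow> g v z = 0 \<Longrightarrow>
      - 1/2 * (\<Sum>b\<in>S. g (N u b) (N v b) / g b b) - \<zeta>/2 * g (J u) (J v)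
      + 1/4 * (\<Sum>b\<in>S. \<Sum>c\<in>S. g (N b c) u * g (N b c) v / (g b b * g c c)) = lam * g u v"
    and einstein_z: "orth_frame g {x. g x z = 0} S \<Longrightarrow> (\<Sum>b\<in>S. g (J b) (J b) / g b b) = 4 * lam * \<zeta>"
begin

lemmas N_simps = bilinear_ladd[OF N_bilin] bilinear_radd[OF N_bilin] bilinear_lmul[OF N_bilin]
  bilinear_rmul[OF N_bilin] bilinear_lneg[OF N_bilin] bilinear_rneg[OF N_bilin]
  bilinear_lsub[OF N_bilin] bilinear_rsub[OF N_bilin] bilinear_lzero[OF N_bilin] bilinear_rzero[OF N_bilin]

lemmas J_simps = linear_add[OF J_linear] linear_scale[OF J_linear] linear_neg[OF J_linear]
  linear_diff[OF J_linear] linear_0[OF J_linear]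

lemma N_anti: "N x y = - N y x"
proof -
  have "N (x + y) (x + y) = N x x + N x y + (N y x + N y y)"
    by (simp only: bilinear_ladd[OF N_bilin] bilinear_radd[OF N_bilin] add_ac)
  then show ?thesis by (simp add: eq_neg_iff_add_eq_0)
qed

lemma N_z' [simp]: "N x z = 0" and N_N' [simp]: "N w (N x y) = 0"
  by (subst N_anti; simp)+

lemma J_V [simp]: "g (J x) z = 0"
  by (simp add: J_skew form_simps)

lemma J_self [simp]: "g (J x) x = 0"
  using J_skew[of x x] sym[of x "J x"] by simp

end

section \<open>The derived algebra of the quotient is Lorentzian\<close>

context einstein_reduction
begin

lemma frame_projection:
  assumes "orth_frame g W S" "d \<in> W"
  shows "g (\<Sum>b\<in>S. (g x b / g b b) *\<^sub>R b) d = g x d"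
proof -
  have "g x d = g d x" by (rule sym)
  also have "\<dots> = (\<Sum>b\<in>S. g d b * g x b / g b b)" by (rule frame_form[OF assms])
  finally show ?thesis by (simp add: sum_left form_simps sym[of d] mult.commute)
qed

abbreviation V where "V \<equiv> {x. g x z = 0}"

definition D where "D = span {N x y | x y. True}"

definition E where "E = {x. g x z = 0 \<and> (\<forall>d\<in>D. g x d = 0)}"

lemma N_linear_right: "linear (N x)"
  using N_bilin by (auto simp: bilinear_def)

lemma subspace_D: "subspace D" and N_in_D [simp]: "N x y \<in> D"
  by (auto simp: D_def intro: span_base)

lemma D_induct:
  assumes "d \<in> D" "subspace {x. P x}" "\<And>x y. P (N x y)" shows "P d"
  using assms(1) unfolding D_def by (rule span_induct) (use assms in auto)

lemma D_central [simp]: assumes "d \<in> D" shows "N d w = 0" "N w d = 0"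
proof -
  show "N d w = 0"
    by (rule D_induct[OF assms]) (auto simp: subspace_def N_simps)
  then show "N w d = 0" using N_anti[of w d] by simp
qed

lemma D_V [simp]: assumes "d \<in> D" shows "g d z = 0"
  by (rule D_induct[OF assms]) (auto simp: subspace_def form_simps)

lemma E_V: "x \<in> E \<Longrightarrow> g x z = 0"
  and E_D: "x \<in> E \<Longrightarrow> d \<in> D \<Longrightarrow> g x d = 0" and D_E: "x \<in> E \<Longrightarrow> d \<in> D \<Longrightarrow> g d x = 0"
  using sym by (auto simp: E_def)

lemma EI:
  assumes "g x z = 0" "\<And>u v. g x (N u v) = 0" shows "x \<in> E"
proof -
  have "g x d = 0" if "d \<in> D" for d
    by (rule D_induct[OF that]) (auto simp: subspace_def form_simps assms)
  then show ?thesis using assms by (simp add: E_def)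
qed

lemma subspace_E: "subspace E"
  by (auto simp: subspace_def E_def form_simps)

text \<open>If the third argument of the cocycle identity lies in \<open>D\<close>, two of its terms
  vanish because \<open>D\<close> is central for \<open>N\<close>; the remaining one says that
  \<open>J D\<close> is orthogonal to \<open>D\<close>.\<close>

lemma J_D_E: assumes d: "d \<in> D" shows "J d \<in> E"
proof -
  have *: "g (J (N x y)) (N u v) = 0" for x y u v
    using cocycle[of x y "N u v"] by (simp add: J_simps form_simps)
  have "g (J d) (N u v) = 0" for u v
    by (rule D_induct[OF d]) (auto simp: subspace_def form_simps J_simps *)
  then show ?thesis by (intro EI) simp_all
qed

lemma D_zero: "d \<in> D \<Longrightarrow> J d = 0 \<Longrightarrow> d = 0"
  by (rule center_zero) simp_all

lemma insert_z_frame: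
  assumes "orth_frame g V S" shows "orth_frame g UNIV (insert z S)"
  using orth_frame_insert(1)[of z UNIV S] assms gzz zeta by auto

lemma linear_vanish_frame:
  assumes S: "orth_frame g V S" and h: "linear h" "h z = 0" "\<And>b. b \<in> S \<Longrightarrow> h b = 0"
  shows "h x = 0"
  unfolding orth_frame_linear[OF insert_z_frame[OF S] UNIV_I h(1), of x]
  using h(2,3) by (intro sum.neutral) auto

text \<open>Orthogonality of \<open>u\<close> to \<open>D\<close> removes the double sum. In
  \<open>einstein_D\<close> the single sum disappears instead, because \<open>D\<close> is central
  for \<open>N\<close>.\<close>

lemma einstein_E:
  assumes S: "orth_frame g V S" and u: "u \<in> E" and v: "g v z = 0"
  shows "(\<Sum>b\<in>S. g (N u b) (N v b) / g b b) + \<zeta> * g (J u) (J v) = - 2 * lam * g u v"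
proof -
  have "(\<Sum>b\<in>S. \<Sum>c\<in>S. g (N b c) u * g (N b c) v / (g b b * g c c)) = 0"
    using D_E[OF u] by (intro sum.neutral ballI) simp
  then show ?thesis using einstein_V[OF S E_V[OF u] v] by simp
qed

lemma einstein_D:
  assumes S: "orth_frame g V S" and u: "u \<in> D" and v: "g v z = 0"
  shows "(\<Sum>b\<in>S. \<Sum>c\<in>S. g (N b c) u * g (N b c) v / (g b b * g c c)) = 4 * lam * g u v + 2 * \<zeta> * g (J u) (J v)"
  using einstein_V[OF S _ v, of u] u by (simp add: form_simps field_simps)

text \<open>Were \<open>z\<close> timelike, \<open>V\<close> would be Euclidean and
  \<open>einstein_z\<close> would give \<open>lam \<le> 0\<close>. The equation at a nonzero value
  of \<open>N\<close> would then make a sum of squares nonpositive, so this value would be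
  orthogonal to all values of \<open>N\<close>, itself included.\<close>

lemma zeta_one: "\<zeta> = 1"
proof (rule ccontr)
  assume "\<zeta> \<noteq> 1"
  then have z1: "\<zeta> = -1" using zeta by simp
  have pos: "0 < g x x" if "g x z = 0" "x \<noteq> 0" for x
    using timelike_orth[of z x] gzz z1 that by simp
  have pos': "0 \<le> g (J x) (J x)" for x
    using pos[of "J x"] by (cases "J x = 0") (auto simp: form_simps)
  obtain S where S: "orth_frame g V S" "\<And>b. b \<in> S \<Longrightarrow> g b b = 1"
    using pos_def_frame[OF subspace_orth[of z]] pos by auto
  have fin: "finite S" using S(1) by (simp add: orth_frame_def)
  have "0 \<le> (\<Sum>b\<in>S. g (J b) (J b) / g b b)"
    by (intro sum_nonneg) (simp add: S(2) pos')
  then have lam: "lam \<le> 0" using einstein_z[OF S(1)] z1 by simp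
  obtain x y where xy: "N x y \<noteq> 0" using N_nontrivial by blast
  let ?d = "N x y"
  have d: "0 < g ?d ?d" using pos xy by simp
  define q where "q = (\<lambda>b c. g (N b c) ?d * g (N b c) ?d / (g b b * g c c))"
  have q0: "0 \<le> q b c" if "b \<in> S" "c \<in> S" for b c using that S(2) by (simp add: q_def)
  have "(\<Sum>b\<in>S. \<Sum>c\<in>S. q b c) = 4 * lam * g ?d ?d - 2 * g (J ?d) (J ?d)"
    using einstein_D[OF S(1), of ?d ?d] z1 by (simp add: q_def)
  also have "\<dots> \<le> 0" using mult_nonpos_nonneg[OF lam less_imp_le[OF d]] pos'[of ?d] by simp
  finally have "(\<Sum>b\<in>S. \<Sum>c\<in>S. q b c) = 0"
    using q0 by (intro antisym sum_nonneg) auto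
  then have "\<forall>b\<in>S. \<forall>c\<in>S. q b c = 0"
    using q0 fin by (simp add: sum_nonneg_eq_0_iff sum_nonneg)
  then have q1: "g (N b c) ?d = 0" if "b \<in> S" "c \<in> S" for b c
    using that S(2) by (auto simp: q_def)
  have q2: "g (N b c) ?d = 0" if "b \<in> S" for b c
    by (rule linear_vanish_frame[OF S(1), of "\<lambda>c. g (N b c) ?d"])
      (use that q1 in \<open>auto simp: linear_iff N_simps form_simps\<close>)
  have "g (N b c) ?d = 0" for b c
    by (rule linear_vanish_frame[OF S(1), of "\<lambda>b. g (N b c) ?d"])
      (use q2 in \<open>auto simp: linear_iff N_simps form_simps\<close>)
  then show False using d by simp
qed

lemma timelike_in_V: obtains t where "g t z = 0" "g t t < 0"
proof -
  obtain t where t: "g t t < 0" using timelike_ref by blast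
  define u where "u = t - g t z *\<^sub>R z"
  have "g u u = g t t - (g t z)\<^sup>2" using gzz zeta_one sym[of z t]
    by (simp add: u_def form_simps power2_eq_square)
  then have "g u u < 0" using t zero_le_power2[of "g t z"] by linarith
  moreover have "g u z = 0" using gzz zeta_one by (simp add: u_def form_simps)
  ultimately show thesis using that by blast
qed

text \<open>Such an \<open>e\<close> is orthogonal to \<open>D\<close> and hence also lies in
  \<open>E\<close>. If it were nonzero, the equations at \<open>e\<close> would make it an
  eigenvector of \<open>J\<close> and \<open>lam\<close> positive, which confines \<open>E\<close>
  to the line of \<open>e\<close>. Then \<open>V\<close> has only one direction modulo
  \<open>D\<close>, and the alternating \<open>N\<close> vanishes.\<close>

lemma no_null_in_semidefinite:
  assumes nonneg: "\<forall>d\<in>D. 0 \<le> g d d" and e: "e \<in> D" "g e e = 0"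
  shows "e = 0"
proof (rule ccontr)
  assume e0: "e \<noteq> 0"
  have eD: "g e d = 0" if "d \<in> D" for d
    using nonneg_form_radical[OF bilin sym subspace_D nonneg e that] .
  have eE: "e \<in> E" using eD e(1) by (simp add: E_def)
  obtain t1 where t1: "g t1 z = 0" "g t1 t1 < 0" using timelike_in_V by blast
  have et1: "g e t1 \<noteq> 0" using timelike_orth[OF t1(2), of e] e(2) e0 by auto
  \<comment> \<open>\<open>f\<close> will complete \<open>e\<close> to a hyperbolic pair;
    \<open>s\<close> and \<open>t\<close> are the orthonormal spacelike and timelike combinations
    with \<open>s + t = e\<close>.\<close>
  define f' where "f' = (1 / g e t1) *\<^sub>R t1"
  define f where "f = f' - (g f' f' / 2) *\<^sub>R e"
  have ef': "g e f' = 1" "g f' e = 1" "g f' z = 0" using et1 t1 sym[of e t1] by (auto simp: f'_def form_simps)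
  have ef: "g e f = 1" "g f e = 1" "g f f = 0" "g f z = 0"
    using ef' e by (simp_all add: f_def form_simps)
  define s where "s = (1/2) *\<^sub>R e + f"
  define t where "t = (1/2) *\<^sub>R e - f"
  have st: "g s s = 1" "g t t = -1" "g s t = 0" "g t s = 0" "g s z = 0" "g t z = 0"
    using ef e by (simp_all add: s_def t_def form_simps)
  have subW: "subspace {x \<in> V. g x t = 0}" "subspace {x \<in> {x \<in> V. g x t = 0}. g x s = 0}"
    by (simp_all add: subspace_def form_simps)
  obtain H where H: "orth_frame g {x \<in> {x \<in> V. g x t = 0}. g x s = 0} H" "\<And>b. b \<in> H \<Longrightarrow> g b b = 1"
  proof (rule pos_def_frame[OF subW(2)])
    show "\<forall>x\<in>{x \<in> {x \<in> V. g x t = 0}. g x s = 0}. x \<noteq> 0 \<longrightarrow> 0 < g x x"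
      using timelike_orth[of t] st by auto
  qed blast
  have S1: "orth_frame g {x \<in> V. g x t = 0} (insert s H)" "s \<notin> H"
    using orth_frame_insert[OF _ _ H(1) subW(1)] st by auto
  have S: "orth_frame g V (insert t (insert s H))" "t \<notin> insert s H"
    using orth_frame_insert[OF _ _ S1(1) subspace_orth] st by auto
  have fin: "finite H" using H(1) by (simp add: orth_frame_def)
  have Neq: "N e y = 0" for y using e by simp
  have "g (J e) (J e) = 0"
    using einstein_E[OF S(1) eE, of e] e zeta_one by (simp add: Neq form_simps)
  then obtain \<mu> where mu: "J e = \<mu> *\<^sub>R e"
    using null_orth_multiple[OF e(2) e0, of "J e"] by auto
  have "\<mu> \<noteq> 0" using D_zero[OF e(1)] mu e0 by auto
  \<comment> \<open>The equation at \<open>(e, f)\<close> and the skewness of \<open>J\<close>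
    evaluate the same number, so \<open>2 * lam\<close> is the square of
    \<open>\<mu>\<close>.\<close>
  moreover have "g (J e) (J f) = - 2 * lam"
    using einstein_E[OF S(1) eE ef(4)] zeta_one by (simp add: Neq form_simps ef)
  moreover have "g (J e) (J f) = - \<mu>\<^sup>2"
    using J_skew[of e f] ef by (simp add: mu form_simps power2_eq_square)
  ultimately have lam: "0 < lam" using zero_less_power2[of \<mu>] by linarith
  have key: "\<exists>c. x = c *\<^sub>R e" if x: "x \<in> E" for x
  proof -
    have xe: "g x e = 0" using E_D[OF x e(1)] .
    \<comment> \<open>Since \<open>N x e = 0\<close>, the vectors \<open>N x s\<close> and
      \<open>N x t\<close> are opposite, and their contributions cancel by the signs of
      \<open>g s s\<close> and \<open>g t t\<close>.\<close>
    have "N x s = N x f" "N x t = - N x f" using e by (simp_all add: s_def t_def N_simps)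
    then have "(\<Sum>b\<in>insert t (insert s H). g (N x b) (N x b) / g b b) = (\<Sum>b\<in>H. g (N x b) (N x b))"
      using fin S(2) S1(2) st H(2) by (simp add: form_simps)
    also have "\<dots> \<ge> 0" using nonneg by (intro sum_nonneg) simp
    moreover have "g (J x) e = 0" by (simp add: J_skew mu form_simps xe)
    then have "0 \<le> g (J x) (J x)" using null_orth_nonneg[OF e(2) e0] by blast
    ultimately have "lam * g x x \<le> 0" using einstein_E[OF S(1) x E_V[OF x]] zeta_one by simp
    then have "g x x \<le> 0" using lam by (simp add: mult_le_0_iff)
    then show ?thesis using null_orth_multiple[OF e(2) e0 xe] by blast
  qed
  define D0 where "D0 = {d \<in> D. g d f = 0}"
  have subD0: "subspace D0" using subspace_D
    by (auto simp: D0_def subspace_def form_simps)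
  have "0 < g d d" if d: "d \<in> D0" "d \<noteq> 0" for d
  proof (rule ccontr)
    assume "\<not> 0 < g d d"
    moreover have "g d e = 0" using eD[of d] d sym[of d e] by (simp add: D0_def)
    ultimately obtain c where c: "d = c *\<^sub>R e" using null_orth_multiple[OF e(2) e0, of d] by auto
    then have "c = 0" using d(1) ef by (simp add: D0_def form_simps)
    then show False using c d(2) by simp
  qed
  then obtain T where T: "orth_frame g D0 T" "\<And>b. b \<in> T \<Longrightarrow> g b b = 1"
    using pos_def_frame[OF subD0] by metis
  have TD: "T \<subseteq> D0" using T(1) by (simp add: orth_frame_def)
  \<comment> \<open>\<open>w\<close> is an element of \<open>D\<close> with the same products
    against \<open>D\<close> as \<open>y\<close>; so \<open>y - w\<close> lies in \<open>E\<close>,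
    hence on the line of \<open>e\<close>.\<close>
  have dD: "y \<in> D" if y: "g y z = 0" "g y e = 0" for y
  proof -
    define w where "w = (\<Sum>b\<in>T. (g y b / g b b) *\<^sub>R b) + g y f *\<^sub>R e"
    have wD: "w \<in> D" unfolding w_def
      using TD e(1) by (intro subspace_add[OF subspace_D] subspace_sum[OF subspace_D] subspace_mul[OF subspace_D])
        (auto simp: D0_def)
    have "g y d = g w d" if d: "d \<in> D" for d
    proof -
      define d0 where "d0 = d - g d f *\<^sub>R e"
      have d0: "d0 \<in> D0" using d e(1) subspace_D ef
        by (simp add: d0_def D0_def form_simps subspace_diff subspace_mul)
      have "g y d0 = g (\<Sum>b\<in>T. (g y b / g b b) *\<^sub>R b) d0"
        using frame_projection[OF T(1) d0] by simp
      also have "\<dots> = g w d0" using eD[of d0] d0 by (simp add: w_def form_simps D0_def)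
      finally have "g y d0 = g w d0" .
      moreover have "g w e = 0" using eD[OF wD] sym[of w e] by simp
      ultimately show ?thesis using y(2) by (simp add: d0_def form_simps)
    qed
    then have "y - w \<in> E" using y wD by (intro EI) (simp_all add: form_simps)
    then obtain c where "y - w = c *\<^sub>R e" using key by blast
    then have "y = w + c *\<^sub>R e" by (simp add: algebra_simps)
    then show ?thesis using wD e(1) subspace_D by (simp add: subspace_add subspace_mul)
  qed
  \<comment> \<open>Modulo \<open>D\<close>, which is central for \<open>N\<close>, both arguments
    are multiples of the same vector \<open>f\<close>.\<close>
  have NV: "N y w = 0" if "g y z = 0" "g w z = 0" for y w
  proof -
    have "y - g y e *\<^sub>R f \<in> D" "w - g w e *\<^sub>R f \<in> D"
      using dD that ef by (simp_all add: form_simps)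
    then have "N (y - g y e *\<^sub>R f + g y e *\<^sub>R f) (w - g w e *\<^sub>R f + g w e *\<^sub>R f) = 0"
      by (simp only: bilinear_ladd[OF N_bilin] bilinear_radd[OF N_bilin] D_central bilinear_lmul[OF N_bilin]
          bilinear_rmul[OF N_bilin] N_self) simp
    then show ?thesis by simp
  qed
  have "N y w = 0" for y w
  proof -
    have "N (y - g y z *\<^sub>R z) (w - g w z *\<^sub>R z) = 0"
      using gzz zeta_one by (intro NV) (simp_all add: form_simps)
    then show ?thesis by (simp add: N_simps)
  qed
  then show False using N_nontrivial by blast
qed

lemma D_E_frame:
  assumes SD: "orth_frame g D SD" and SE: "orth_frame g E SE"
  shows "orth_frame g V (SD \<union> SE)" and "SD \<inter> SE = {}"
proof -
  have D: "finite SD" "SD \<subseteq> D" "\<forall>b\<in>SD. g b b \<noteq> 0" "\<forall>b\<in>SD. \<forall>c\<in>SD. b \<noteq> c \<longrightarrow> g b c = 0"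
    using SD by (auto simp: orth_frame_def)
  have E: "finite SE" "SE \<subseteq> E" "\<forall>b\<in>SE. g b b \<noteq> 0" "\<forall>b\<in>SE. \<forall>c\<in>SE. b \<noteq> c \<longrightarrow> g b c = 0"
    using SE by (auto simp: orth_frame_def)
  have o: "g b c = 0" "g c b = 0" if "b \<in> SD" "c \<in> SE" for b c
    using that D(2) E(2) E_D D_E by blast+
  show dis: "SD \<inter> SE = {}" using o D(3) by blast
  have "x = (\<Sum>b\<in>SD \<union> SE. (g x b / g b b) *\<^sub>R b)" if x: "g x z = 0" for x
  proof -
    define w where "w = (\<Sum>b\<in>SD. (g x b / g b b) *\<^sub>R b)"
    have wD: "w \<in> D" unfolding w_def
      using D(2) by (intro subspace_sum[OF subspace_D] subspace_mul[OF subspace_D]) auto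
    have "g x d = g w d" if d: "d \<in> D" for d
      unfolding w_def using frame_projection[OF SD d] by simp
    then have yE: "x - w \<in> E" using x wD by (intro EI) (simp_all add: form_simps)
    have "x - w = (\<Sum>b\<in>SE. (g (x - w) b / g b b) *\<^sub>R b)" by (rule orth_frame_expand[OF SE yE])
    also have "\<dots> = (\<Sum>b\<in>SE. (g x b / g b b) *\<^sub>R b)"
      using E(2) D_E wD by (intro sum.cong) (auto simp: form_simps)
    finally have "x = w + (\<Sum>b\<in>SE. (g x b / g b b) *\<^sub>R b)" by (simp add: algebra_simps)
    then show ?thesis unfolding w_def using D(1) E(1) dis by (simp add: sum.union_disjoint)
  qed
  then show "orth_frame g V (SD \<union> SE)" unfolding orth_frame_def
    using D E o E_V by (intro conjI ballI) auto
qed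

end

section \<open>The Einstein equations in a frame adapted to \<open>D\<close> and
  \<open>E\<close>\<close>

locale split_frame = einstein_reduction +
  fixes SD SE
  assumes SD: "orth_frame g D SD" and SE: "orth_frame g E SE"
begin

lemma finite_SD: "finite SD" and SD_D: "d \<in> SD \<Longrightarrow> d \<in> D" and SD_nz: "d \<in> SD \<Longrightarrow> g d d \<noteq> 0"
  and finite_SE: "finite SE" and SE_E: "b \<in> SE \<Longrightarrow> b \<in> E" and SE_nz: "b \<in> SE \<Longrightarrow> g b b \<noteq> 0"
  using SD SE by (auto simp: orth_frame_def)

lemmas S = D_E_frame(1)[OF SD SE]

lemma sum_S: "(\<Sum>b\<in>SD \<union> SE. f b) = (\<Sum>b\<in>SD. f b) + (\<Sum>b\<in>SE. f b)" for f :: "'a \<Rightarrow> real"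
  using finite_SD finite_SE D_E_frame(2)[OF SD SE] by (simp add: sum.union_disjoint)

lemma E_eq:
  assumes u: "u \<in> E" and v: "v \<in> E"
  shows "(\<Sum>b\<in>SE. g (N u b) (N v b) / g b b) = - 2 * lam * g u v - g (J u) (J v)"
  using einstein_E[OF S u E_V[OF v]] zeta_one SD_D by (simp add: sum_S form_simps)

lemma D_eq:
  assumes u: "u \<in> D" and v: "g v z = 0"
  shows "(\<Sum>b\<in>SE. \<Sum>c\<in>SE. g (N b c) u * g (N b c) v / (g b b * g c c)) = 4 * lam * g u v + 2 * g (J u) (J v)"
  using einstein_D[OF S u v] zeta_one SD_D by (simp add: sum_S form_simps)

lemma z_eq: "(\<Sum>d\<in>SD. g (J d) (J d) / g d d) + (\<Sum>b\<in>SE. g (J b) (J b) / g b b) = 4 * lam"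
  using einstein_z[OF S] zeta_one by (simp add: sum_S)

text \<open>The mixed Einstein equation: with one argument in \<open>D\<close> and the other in
  \<open>E\<close>, only the term with \<open>J\<close> is left.\<close>

lemma J_D_J_E: assumes "d \<in> D" "x \<in> E" shows "g (J d) (J x) = 0"
  using D_eq[of d x] assms E_D D_E E_V by simp

lemma N_expand: "g (N x y) (N u v) = (\<Sum>d\<in>SD. g (N x y) d * g (N u v) d / g d d)"
  using frame_form[OF SD, of "N x y" "N u v"] by simp

text \<open>The squares of the structure constants of \<open>N\<close> are summed twice, by the
  equations on \<open>D\<close> and by those on \<open>E\<close>; \<open>z_eq\<close> eliminates the
  trace of \<open>J\<close> over \<open>E\<close>.\<close>

lemma trace_identity:
  "(\<Sum>d\<in>SD. g (J d) (J d) / g d d) = - lam * (4 * card SD + 2 * card SE + 4)"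
proof -
  let ?A = "\<Sum>d\<in>SD. g (J d) (J d) / g d d"
  have "(\<Sum>d\<in>SD. (\<Sum>b\<in>SE. \<Sum>c\<in>SE. g (N b c) d * g (N b c) d / (g b b * g c c)) / g d d)
     = (\<Sum>d\<in>SD. (4 * lam * g d d + 2 * g (J d) (J d)) / g d d)"
    using D_eq SD_D by (intro sum.cong) auto
  also have "\<dots> = (\<Sum>d\<in>SD. 4 * lam + 2 * (g (J d) (J d) / g d d))"
    using SD_nz by (intro sum.cong) (auto simp: field_simps)
  also have "\<dots> = 4 * lam * card SD + 2 * ?A" by (simp add: sum.distrib sum_distrib_left)
  finally have 1: "(\<Sum>d\<in>SD. (\<Sum>b\<in>SE. \<Sum>c\<in>SE. g (N b c) d * g (N b c) d / (g b b * g c c)) / g d d)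
     = 4 * lam * card SD + 2 * ?A" .
  have "(\<Sum>b\<in>SE. (\<Sum>c\<in>SE. g (N b c) (N b c) / g c c) / g b b) = (\<Sum>b\<in>SE. (- 2 * lam * g b b - g (J b) (J b)) / g b b)"
    using E_eq SE_E by (intro sum.cong) auto
  also have "\<dots> = (\<Sum>b\<in>SE. - 2 * lam - g (J b) (J b) / g b b)"
    using SE_nz by (intro sum.cong) (auto simp: field_simps)
  also have "\<dots> = - 2 * lam * card SE - (4 * lam - ?A)"
    using z_eq by (simp add: sum_subtractf)
  finally have 2: "(\<Sum>b\<in>SE. (\<Sum>c\<in>SE. g (N b c) (N b c) / g c c) / g b b) = - 2 * lam * card SE - (4 * lam - ?A)" .
  have "(\<Sum>b\<in>SE. (\<Sum>c\<in>SE. g (N b c) (N b c) / g c c) / g b b)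
     = (\<Sum>b\<in>SE. \<Sum>c\<in>SE. \<Sum>d\<in>SD. g (N b c) d * g (N b c) d / (g b b * g c c) / g d d)"
    by (simp add: N_expand sum_divide_distrib mult.commute mult.left_commute)
  also have "\<dots> = (\<Sum>d\<in>SD. \<Sum>b\<in>SE. \<Sum>c\<in>SE. g (N b c) d * g (N b c) d / (g b b * g c c) / g d d)"
    by (simp add: sum.swap[of _ SD])
  also have "\<dots> = (\<Sum>d\<in>SD. (\<Sum>b\<in>SE. \<Sum>c\<in>SE. g (N b c) d * g (N b c) d / (g b b * g c c)) / g d d)"
    by (simp add: sum_divide_distrib)
  finally show ?thesis using 1 2 by (simp add: algebra_simps)
qed

end

section \<open>Excluding a positive definite \<open>D\<close>\<close>

context einstein_reduction
begin

text \<open>If \<open>D\<close> were Euclidean, \<open>E\<close> would contain a timelike vector.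
  The equation there gives \<open>lam > 0\<close> and an upper bound for \<open>J\<close>, which is
  carried over to a lower bound for \<open>g (J d) (J d)\<close> on a unit frame of
  \<open>D\<close>. The sum of these bounds exceeds what \<open>trace_identity\<close>
  allows.\<close>

lemma D_not_pos_def: "\<exists>d\<in>D. d \<noteq> 0 \<and> g d d \<le> 0"
proof (rule ccontr)
  assume "\<not> ?thesis"
  then have pos: "\<forall>d\<in>D. d \<noteq> 0 \<longrightarrow> 0 < g d d" by force
  then have nn: "0 \<le> g (N x y) (N x y)" for x y
    by (cases "N x y = 0") (auto simp: form_simps)
  obtain SD where SD: "orth_frame g D SD" "\<And>b. b \<in> SD \<Longrightarrow> g b b = 1"
    using pos_def_frame[OF subspace_D pos] by metis
  note SD_unit = SD(2)
  have frame_E: "\<exists>SF. orth_frame g E (insert x SF) \<and> (\<forall>b\<in>SF. g b b = 1) \<and> x \<notin> SF"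
    if x: "x \<in> E" "g x x = -1" for x
  proof -
    have sub: "subspace {y \<in> E. g y x = 0}" using subspace_E by (auto simp: subspace_def form_simps)
    have "\<forall>y\<in>{y \<in> E. g y x = 0}. y \<noteq> 0 \<longrightarrow> 0 < g y y" using timelike_orth[of x] x by auto
    from pos_def_frame[OF sub this] obtain SF where
      SF: "orth_frame g {y \<in> E. g y x = 0} SF" "\<And>b. b \<in> SF \<Longrightarrow> g b b = 1" by blast
    show ?thesis using orth_frame_insert[OF _ x(1) SF(1) subspace_E] SF(2) x(2)
      by (intro exI[of _ SF]) auto
  qed
  have bound: "g (J x) (J x) \<le> 2 * lam" and lam_pos: "0 < lam" if x: "x \<in> E" "g x x = -1" for x
  proof -
    obtain SF where SF: "orth_frame g E (insert x SF)" "\<And>b. b \<in> SF \<Longrightarrow> g b b = 1" "x \<notin> SF"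
      using frame_E[OF x] by auto
    interpret split_frame g z N J \<zeta> lam SD "insert x SF" by unfold_locales (fact SD(1) SF(1))+
    have fin: "finite SF" using finite_SE by simp
    have "(\<Sum>b\<in>SF. g (N x b) (N x b)) = (\<Sum>b\<in>SF. g (N x b) (N x b) / g b b)"
      using SF(2) by simp
    then have eq: "(\<Sum>b\<in>SF. g (N x b) (N x b)) = 2 * lam - g (J x) (J x)"
      using E_eq[OF x(1) x(1)] x(2) SF fin by (simp add: form_simps)
    have ge: "0 \<le> (\<Sum>b\<in>SF. g (N x b) (N x b))" by (intro sum_nonneg) (rule nn)
    then show "g (J x) (J x) \<le> 2 * lam" using eq by simp
    \<comment> \<open>Otherwise both nonnegative terms in \<open>eq\<close> vanish, so
      \<open>N x\<close> and \<open>J x\<close> are zero and \<open>x\<close> would be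
      central.\<close>
    show "0 < lam"
    proof (rule ccontr)
      assume "\<not> 0 < lam"
      moreover have J0: "0 \<le> g (J x) (J x)" by (rule timelike_orth_nonneg[of x]) (simp_all add: x)
      ultimately have 0: "(\<Sum>b\<in>SF. g (N x b) (N x b)) = 0" "g (J x) (J x) = 0" using eq ge by linarith+
      have "N x b = 0" if "b \<in> SF" for b
      proof -
        have "g (N x b) (N x b) = 0" using 0(1) sum_nonneg_eq_0_iff[OF fin, of "\<lambda>b. g (N x b) (N x b)"] nn that by simp
        then show ?thesis using pos by force
      qed
      then have N0: "N x b = 0" if "b \<in> SD \<union> insert x SF" for b
        using that SD_D by auto
      have "N x y = 0" for y
        by (rule linear_vanish_frame[OF S N_linear_right N_z' N0])
      moreover have "J x = 0" using timelike_orth_zero[of x "J x"] 0(2) x(2) by simp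
      ultimately have "x = 0" using center_zero[OF E_V[OF x(1)]] by blast
      then show False using x(2) by (simp add: form_simps)
    qed
  qed
  obtain t1 where t1: "g t1 z = 0" "g t1 t1 < 0" using timelike_in_V by blast
  have fD: "finite SD" "SD \<subseteq> D" using SD(1) by (auto simp: orth_frame_def)
  \<comment> \<open>Removing the component in \<open>D\<close>, whose norm is nonnegative, keeps
    \<open>t1\<close> timelike and moves it into \<open>E\<close>.\<close>
  define w where "w = (\<Sum>b\<in>SD. (g t1 b / g b b) *\<^sub>R b)"
  have wD: "w \<in> D" unfolding w_def
    using fD(2) by (intro subspace_sum[OF subspace_D] subspace_mul[OF subspace_D]) auto
  have w: "g t1 d = g w d" if d: "d \<in> D" for d
    unfolding w_def using frame_projection[OF SD(1) d] by simp
  have tE: "t1 - w \<in> E" using t1 wD w by (intro EI) (simp_all add: form_simps)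
  have "g (t1 - w) (t1 - w) = g t1 t1 - g w w" using w[OF wD] sym[of w t1] by (simp add: form_simps)
  moreover have "0 \<le> g w w" using pos wD by (cases "w = 0") (auto simp: form_simps)
  ultimately have neg: "g (t1 - w) (t1 - w) < 0" using t1(2) by linarith
  define t where "t = (1 / sqrt (- g (t1 - w) (t1 - w))) *\<^sub>R (t1 - w)"
  have t: "t \<in> E" "g t t = -1"
    using tE neg subspace_E
    by (simp_all add: t_def subspace_mul bilinear_lmul[OF bilin] bilinear_rmul[OF bilin] del: real_sqrt_minus)
  have lam: "0 < lam" using lam_pos[OF t] .
  have ad: "- 2 * lam \<le> g (J d) (J d)" if d: "d \<in> SD" for d
  proof (cases "0 \<le> g (J d) (J d)")
    case True then show ?thesis using lam by linarith
  next
    case False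
    define a where "a = - g (J d) (J d)"
    have a: "0 < a" "g (J d) (J d) = - a" using False by (simp_all add: a_def)
    have dD: "d \<in> D" using d fD by blast
    define x where "x = (1 / sqrt a) *\<^sub>R J d"
    have sa: "sqrt a * sqrt a = a" using a(1) by simp
    have xE: "x \<in> E" unfolding x_def by (intro subspace_mul[OF subspace_E] J_D_E dD)
    have gx: "g x x = -1" using a sa by (simp add: x_def form_simps)
    have "g (J x) (J x) = g (J (J d)) (J (J d)) / a" using sa by (simp add: x_def form_simps J_simps)
    then have 1: "g (J (J d)) (J (J d)) \<le> 2 * lam * a"
      using mult_left_mono[OF bound[OF xE gx], of a] a(1) by (simp add: mult.commute)
    \<comment> \<open>The part of \<open>J (J d)\<close> orthogonal to \<open>d\<close>. It is also
      orthogonal to \<open>J d\<close>, which is timelike here, so its norm is nonnegative and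
      \<open>a * a\<close> is a lower bound for the norm of \<open>J (J d)\<close>.\<close>
    define y where "y = J (J d) - a *\<^sub>R d"
    have "g y (J d) = 0" using sym[of d "J d"] by (simp add: y_def form_simps)
    then have "0 \<le> g y y" using timelike_orth_nonneg[of "J d" y] a by simp
    moreover have "g (J (J d)) d = a" using J_skew[of "J d" d] a by simp
    ultimately have "a * a \<le> g (J (J d)) (J (J d))"
      using sym[of d "J (J d)"] SD(2)[OF d] by (simp add: y_def form_simps)
    then have "a * a \<le> 2 * lam * a" using 1 by simp
    then have "a \<le> 2 * lam" using a(1) by simp
    then show ?thesis using a by simp
  qed
  obtain SF where SF: "orth_frame g E (insert t SF)" using frame_E[OF t] by auto
  interpret split_frame g z N J \<zeta> lam SD "insert t SF" by unfold_locales (fact SD(1) SF(1))+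
  have "(\<Sum>d\<in>SD. - 2 * lam) \<le> (\<Sum>d\<in>SD. g (J d) (J d) / g d d)"
    using ad SD_unit by (intro sum_mono) simp
  then have "- 2 * lam * card SD \<le> - lam * (4 * card SD + 2 * card (insert t SF) + 4)"
    unfolding trace_identity by (simp add: mult_ac)
  then have "lam * (2 * card SD + 2 * card (insert t SF) + 4) \<le> 0" by (simp add: algebra_simps)
  moreover have "0 < lam * (2 * card SD + 2 * card (insert t SF) + 4)"
    using lam by (intro mult_pos_pos) auto
  ultimately show False by simp
qed

lemma D_timelike: "\<exists>d\<in>D. g d d < 0"
  using D_not_pos_def no_null_in_semidefinite by (metis less_le not_le)

end

section \<open>The weighted trace identity\<close>

context symmetric_form
begin

lemma pos_def_frame_extend:
  assumes W: "subspace W" "\<forall>x\<in>W. x \<noteq> 0 \<longrightarrow> 0 < g x x"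
    and T: "finite T" "T \<subseteq> W" "\<forall>b\<in>T. \<forall>c\<in>T. g b c = (if b = c then 1 else 0)"
  shows "\<exists>S. orth_frame g W S \<and> T \<subseteq> S \<and> (\<forall>b\<in>S. g b b = 1)"
proof -
  define F where "F = {x \<in> W. \<forall>b\<in>T. g x b = 0}"
  have subF: "subspace F" using W(1) by (auto simp: F_def subspace_def form_simps)
  have posF: "\<forall>x\<in>F. x \<noteq> 0 \<longrightarrow> 0 < g x x" using W(2) by (simp add: F_def)
  obtain S where S: "orth_frame g F S" "\<And>b. b \<in> S \<Longrightarrow> g b b = 1"
    using pos_def_frame[OF subF posF] by blast
  have S': "finite S" "S \<subseteq> F" "\<forall>b\<in>S. \<forall>c\<in>S. b \<noteq> c \<longrightarrow> g b c = 0"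
    using S(1) by (auto simp: orth_frame_def)
  have o: "g b c = 0" "g c b = 0" if "b \<in> T" "c \<in> S" for b c
    using that S'(2) sym[of b c] by (auto simp: F_def)
  have dis: "T \<inter> S = {}" using o T(3) by fastforce
  have ex: "x = (\<Sum>b\<in>T \<union> S. (g x b / g b b) *\<^sub>R b)" if x: "x \<in> W" for x
  proof -
    define w where "w = (\<Sum>b\<in>T. (g x b / g b b) *\<^sub>R b)"
    have wW: "w \<in> W" unfolding w_def
      using T(2) by (intro subspace_sum[OF W(1)] subspace_mul[OF W(1)]) auto
    have "g w c = g x c" if c: "c \<in> T" for c
    proof -
      have "g w c = (\<Sum>b\<in>T. g x b / g b b * g b c)" by (simp add: w_def sum_left form_simps)
      also have "\<dots> = (\<Sum>b\<in>T. if b = c then g x c else 0)"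
        using T(3) c by (intro sum.cong) auto
      also have "\<dots> = g x c" using T(1) c by simp
      finally show ?thesis .
    qed
    then have yF: "x - w \<in> F" using x wW W(1) by (simp add: F_def form_simps subspace_diff)
    have wS: "g w c = 0" if "c \<in> S" for c
      using o that by (simp add: w_def sum_left form_simps)
    have "x - w = (\<Sum>b\<in>S. (g (x - w) b / g b b) *\<^sub>R b)" by (rule orth_frame_expand[OF S(1) yF])
    also have "\<dots> = (\<Sum>b\<in>S. (g x b / g b b) *\<^sub>R b)"
      using wS by (intro sum.cong) (auto simp: form_simps)
    finally have "x = w + (\<Sum>b\<in>S. (g x b / g b b) *\<^sub>R b)" by (simp add: algebra_simps)
    then show ?thesis unfolding w_def using T(1) S'(1) dis by (simp add: sum.union_disjoint)
  qed
  have "S \<subseteq> W" using S'(2) by (auto simp: F_def)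
  moreover have "\<forall>b\<in>T \<union> S. g b b = 1" using T(3) S(2) by auto
  moreover have "\<forall>b\<in>T \<union> S. \<forall>c\<in>T \<union> S. b \<noteq> c \<longrightarrow> g b c = 0"
    using T(3) S'(3) o by (metis Un_iff)
  ultimately have "orth_frame g W (T \<union> S)" unfolding orth_frame_def
    using T(1,2) S'(1) ex by (intro conjI ballI) auto
  then show ?thesis using \<open>\<forall>b\<in>T \<union> S. g b b = 1\<close> by (intro exI[of _ "T \<union> S"]) auto
qed

lemma frame_bilinear:
  fixes h :: "'a \<Rightarrow> 'a \<Rightarrow> real"
  assumes S: "orth_frame g W S" "\<And>b. b \<in> S \<Longrightarrow> g b b = 1" and h: "bilinear h" and x: "x \<in> W" "y \<in> W"
  shows "h x y = (\<Sum>b\<in>S. \<Sum>c\<in>S. g x b * g y c * h b c)"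
proof -
  have l: "linear (\<lambda>x. h x y)" "linear (h x)" for x y using h by (auto simp: bilinear_def)
  have "h x y = (\<Sum>b\<in>S. g x b * h b y)"
    unfolding orth_frame_linear[OF S(1) x(1) l(1)[of y]] using S(2) by simp
  also have "\<dots> = (\<Sum>b\<in>S. g x b * (\<Sum>c\<in>S. g y c * h b c))"
  proof (rule sum.cong[OF refl])
    fix b
    show "g x b * h b y = g x b * (\<Sum>c\<in>S. g y c * h b c)"
      unfolding orth_frame_linear[OF S(1) x(2) l(2)[of b]] using S(2) by simp
  qed
  finally show ?thesis by (simp add: sum_distrib_left mult.assoc)
qed

end

text \<open>The frame of \<open>D\<close> is normalised so that its images under \<open>J\<close>
  are part of an orthonormal frame of \<open>E\<close>. The norms \<open>g d d\<close> stay free;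
  they become the parameters of the two families.\<close>

locale adapted_frame = einstein_reduction g z N J \<zeta> lam + split_frame g z N J \<zeta> lam SD SE
  for g :: "'a::euclidean_space \<Rightarrow> 'a \<Rightarrow> real" and z N J \<zeta> lam SD SE +
  fixes d0 :: 'a
  assumes JJ: "\<And>d d'. d \<in> SD \<Longrightarrow> d' \<in> SD \<Longrightarrow> g (J d) (J d') = (if d = d' then 1 else 0)"
    and d0: "d0 \<in> SD" "g d0 d0 < 0" and SE1: "\<And>b. b \<in> SE \<Longrightarrow> g b b = 1" and J_SE: "J ` SD \<subseteq> SE"

lemma (in einstein_reduction) adapted_frame_exists: "\<exists>SD SE d0. adapted_frame g z N J \<zeta> lam SD SE d0"
proof -
  obtain t where t: "t \<in> D" "g t t < 0" using D_timelike by blast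
  \<comment> \<open>\<open>J\<close> maps \<open>D\<close> injectively into the Euclidean
    \<open>E\<close>, so \<open>p\<close> is positive definite on \<open>D\<close> and can be
    diagonalised together with the indefinite \<open>g\<close>.\<close>
  define p where "p = (\<lambda>x y. g (J x) (J y))"
  have p: "bilinear p" "\<And>x y. p x y = p y x"
    by (auto simp: p_def bilinear_def linear_iff J_simps form_simps sym)
  have pE: "0 < g x x" if "x \<in> E" "x \<noteq> 0" for x
    using timelike_orth[OF t(2) E_D[OF that(1) t(1)] that(2)] .
  have pD: "\<forall>d\<in>D. d \<noteq> 0 \<longrightarrow> 0 < p d d" using pE J_D_E D_zero by (auto simp: p_def)
  obtain SD where SD: "finite SD" "SD \<subseteq> D" "\<forall>b\<in>SD. \<forall>c\<in>SD. p b c = (if b = c then 1 else 0)"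
     "\<forall>b\<in>SD. \<forall>c\<in>SD. b \<noteq> c \<longrightarrow> g b c = 0" "\<forall>x\<in>D. x = (\<Sum>b\<in>SD. p x b *\<^sub>R b)"
    using simultaneous_diagonalization[OF p bilin sym subspace_D pD] by (elim exE conjE)
  have spanD: "x \<in> span SD" if "x \<in> D" for x
    by (subst bspec[OF SD(5) that]) (intro span_sum span_scale span_base)
  \<comment> \<open>A null member would be orthogonal to all of \<open>D\<close>, in particular to
    the timelike \<open>t\<close>, and therefore zero.\<close>
  have nz: "\<forall>b\<in>SD. g b b \<noteq> 0"
  proof
    fix b assume b: "b \<in> SD"
    show "g b b \<noteq> 0"
    proof
      assume 0: "g b b = 0"
      have "g c b = 0" if "c \<in> SD" for c using SD(4) that b 0 by (cases "c = b") auto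
      then have "g (\<Sum>c\<in>SD. p t c *\<^sub>R c) b = 0" by (simp add: sum_left form_simps)
      then have "g t b = 0" using bspec[OF SD(5) t(1)] by simp
      then have "b = 0" using timelike_orth_zero[OF t(2), of b] sym[of b t] 0 by simp
      then show False using bspec[OF bspec[OF SD(3) b] b] by (simp add: p_def J_simps form_simps)
    qed
  qed
  have frD: "orth_frame g D SD" unfolding orth_frame_def
    using SD nz orthogonal_span_expand[OF SD(1) nz SD(4) spanD] by (intro conjI ballI) blast+
  have "\<exists>d0\<in>SD. g d0 d0 < 0"
  proof (rule ccontr)
    assume "\<not> ?thesis"
    then have "0 \<le> (\<Sum>b\<in>SD. (g t b)\<^sup>2 / g b b)" by (intro sum_nonneg) (auto simp: not_less)
    then show False using frame_sq[OF frD t(1)] t(2) by simp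
  qed
  then obtain d0 where d0: "d0 \<in> SD" "g d0 d0 < 0" by blast
  have JJ: "\<And>d d'. d \<in> SD \<Longrightarrow> d' \<in> SD \<Longrightarrow> g (J d) (J d') = (if d = d' then 1 else 0)"
    using SD(3) by (simp add: p_def)
  have JT: "\<forall>b\<in>J ` SD. \<forall>c\<in>J ` SD. g b c = (if b = c then 1 else 0)"
    using JJ by (metis (no_types, lifting) imageE zero_neq_one)
  have "finite (J ` SD)" "J ` SD \<subseteq> E" using SD(1,2) J_D_E by auto
  from pos_def_frame_extend[OF subspace_E _ this JT] pE obtain SE where
    SE: "orth_frame g E SE" "J ` SD \<subseteq> SE" "\<forall>b\<in>SE. g b b = 1" by metis
  have "adapted_frame g z N J \<zeta> lam SD SE d0"
    by unfold_locales (use frD SE JJ d0 in auto)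
  then show ?thesis by blast
qed

context adapted_frame
begin

abbreviation "\<beta> \<equiv> J d0"

lemma frame_S: "orth_frame g V (SD \<union> SE)" by (rule S)

lemma SD_orth: "d \<in> SD \<Longrightarrow> d' \<in> SD \<Longrightarrow> d \<noteq> d' \<Longrightarrow> g d d' = 0"
  using SD by (simp add: orth_frame_def)

lemma SE_orth: "b \<in> SE \<Longrightarrow> c \<in> SE \<Longrightarrow> b \<noteq> c \<Longrightarrow> g b c = 0"
  using SE by (simp add: orth_frame_def)

lemma SD_pos: assumes "d \<in> SD" "d \<noteq> d0" shows "0 < g d d"
proof -
  have "d \<noteq> 0" using SD_nz[OF assms(1)] by (auto simp: form_simps)
  then show ?thesis using timelike_orth[OF d0(2), of d] SD_orth assms d0 by simp
qed

lemma J_inj: "inj_on J SD"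
  by (rule inj_onI) (metis JJ zero_neq_one)

text \<open>\<open>J_D_J_E\<close> excludes components in \<open>E\<close>, and orthonormality of
  the vectors \<open>J d\<close> leaves only the component along \<open>d\<close>.\<close>

lemma JJ_D: assumes d: "d \<in> SD" shows "J (J d) = - (1 / g d d) *\<^sub>R d"
proof -
  have "J (J d) = (\<Sum>b\<in>SD \<union> SE. (g (J (J d)) b / g b b) *\<^sub>R b)"
    by (rule orth_frame_expand[OF S]) simp
  also have "\<dots> = (\<Sum>b\<in>SD \<union> SE. if b = d then - (1 / g d d) *\<^sub>R d else 0)"
  proof (rule sum.cong[OF refl])
    fix b assume b: "b \<in> SD \<union> SE"
    have dn: "d \<notin> SE" using d D_E_frame(2)[OF SD SE] by blast
    have "g (J (J d)) b = - g (J d) (J b)" by (rule J_skew)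
    moreover have "g (J d) (J b) = 0" if "b \<in> SE"
      using J_D_J_E[of d b] that d SD_D SE_E by simp
    ultimately show "(g (J (J d)) b / g b b) *\<^sub>R b = (if b = d then - (1 / g d d) *\<^sub>R d else 0)"
      using b JJ[OF d, of b] dn by auto
  qed
  also have "\<dots> = - (1 / g d d) *\<^sub>R d" using d finite_SD finite_SE by simp
  finally show ?thesis .
qed

lemma JJ_norm: "d \<in> SD \<Longrightarrow> g (J (J d)) (J (J d)) = 1 / g d d"
  by (simp add: JJ_D form_simps)

lemma beta_E: "\<beta> \<in> E" and beta_SE: "\<beta> \<in> SE" and beta_beta: "g \<beta> \<beta> = 1"
  using d0 J_SE SE_E SE1 by auto

text \<open>The part of the trace of \<open>J\<close> over \<open>E\<close> that does not come from
  \<open>J D\<close>. It decides the sign of \<open>lam\<close>: by \<open>rest_eq\<close> it is a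
  positive multiple of \<open>lam\<close>, and all its terms are nonnegative.\<close>

definition rest where "rest = (\<Sum>x\<in>SE - J ` SD. g (J x) (J x))"

text \<open>By skewness of \<open>J\<close>, orthogonality of \<open>x\<close> to
  \<open>\<beta> = J d0\<close> is orthogonality of \<open>J x\<close> to the timelike
  \<open>d0\<close>.\<close>

lemma J_rest_nonneg: assumes "x \<in> SE - J ` SD" shows "0 \<le> g (J x) (J x)"
proof -
  have "g (J x) d0 = - g x \<beta>" by (rule J_skew)
  also have "g x \<beta> = 0" using SE_orth[of x \<beta>] assms beta_SE d0 by auto
  finally show ?thesis using timelike_orth_nonneg[OF d0(2)] by simp
qed

lemma sum_J_SE: "(\<Sum>x\<in>SE. g (J x) (J x)) = (\<Sum>d\<in>SD. 1 / g d d) + rest"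
proof -
  have "(\<Sum>x\<in>SE. g (J x) (J x)) = rest + (\<Sum>x\<in>J ` SD. g (J x) (J x))"
    unfolding rest_def using J_SE finite_SE by (rule sum.subset_diff)
  also have "(\<Sum>x\<in>J ` SD. g (J x) (J x)) = (\<Sum>d\<in>SD. 1 / g d d)"
    by (simp add: sum.reindex[OF J_inj] JJ_norm)
  finally show ?thesis by simp
qed

lemma sum_inverse: "(\<Sum>d\<in>SD. 1 / g d d) = - lam * (4 * card SD + 2 * card SE + 4)"
  using trace_identity by (simp add: JJ)

lemma rest_eq: "rest = lam * (8 * card SD + 4 * card SE + 12)"
proof -
  have "(\<Sum>d\<in>SD. 1 / g d d) + (\<Sum>b\<in>SE. g (J b) (J b)) = 4 * lam"
    using z_eq by (simp add: JJ SE1)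
  then show ?thesis unfolding sum_J_SE sum_inverse by (simp add: algebra_simps)
qed

lemma rest_nonneg: "0 \<le> rest"
  unfolding rest_def by (intro sum_nonneg J_rest_nonneg)

definition "\<theta>D d = (if d = d0 then - 2 else 1 :: real)"
definition "\<theta>E x = (if x = \<beta> then - 2 else 1 :: real)"
definition "Q d x y = (g (N x y) d)\<^sup>2 / g d d * (\<theta>D d + \<theta>E x + \<theta>E y)"

lemma weighted_sum_SD: "(\<Sum>d\<in>SD. \<theta>D d * f d) = (\<Sum>d\<in>SD. f d) - 3 * f d0"
proof -
  have "(\<Sum>d\<in>SD. \<theta>D d * f d) = (\<Sum>d\<in>SD. f d - (if d = d0 then 3 * f d0 else 0))"
    by (intro sum.cong) (auto simp: \<theta>D_def)
  then show ?thesis using d0 finite_SD by (simp add: sum_subtractf)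
qed

lemma weighted_sum_SE: "(\<Sum>x\<in>SE. \<theta>E x * f x) = (\<Sum>x\<in>SE. f x) - 3 * f \<beta>"
proof -
  have "(\<Sum>x\<in>SE. \<theta>E x * f x) = (\<Sum>x\<in>SE. f x - (if x = \<beta> then 3 * f \<beta> else 0))"
    by (intro sum.cong) (auto simp: \<theta>E_def)
  then show ?thesis using beta_SE finite_SE by (simp add: sum_subtractf)
qed

lemma Q_nonneg: assumes "d \<in> SD" "x \<in> SE" "y \<in> SE" shows "0 \<le> Q d x y"
proof (cases "d = d0")
  case True
  have "(g (N x y) d)\<^sup>2 / g d d \<le> 0" using True d0 by (simp add: divide_nonneg_neg)
  moreover have "\<theta>D d + \<theta>E x + \<theta>E y \<le> 0" using True by (simp add: \<theta>D_def \<theta>E_def)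
  ultimately show ?thesis unfolding Q_def by (rule mult_nonpos_nonpos)
next
  case False
  show ?thesis
  proof (cases "x = \<beta> \<and> y = \<beta>")
    case True then show ?thesis by (simp add: Q_def form_simps)
  next
    case f: False
    have "0 \<le> (g (N x y) d)\<^sup>2 / g d d" using SD_pos[OF assms(1) False] by simp
    moreover have "0 \<le> \<theta>D d + \<theta>E x + \<theta>E y" using False f by (auto simp: \<theta>D_def \<theta>E_def)
    ultimately show ?thesis unfolding Q_def by (rule mult_nonneg_nonneg)
  qed
qed

lemma Q_sum: "(\<Sum>d\<in>SD. \<Sum>x\<in>SE. \<Sum>y\<in>SE. Q d x y) = 4 * lam * (real (card SD) - real (card SE)) - 2 * rest"
proof -
  let ?q = "\<lambda>d x y. (g (N x y) d)\<^sup>2 / g d d"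
  have dq: "(\<Sum>x\<in>SE. \<Sum>y\<in>SE. ?q d x y) = 4 * lam + 2 * (1 / g d d)" if d: "d \<in> SD" for d
  proof -
    have "(\<Sum>x\<in>SE. \<Sum>y\<in>SE. ?q d x y) = (\<Sum>x\<in>SE. \<Sum>y\<in>SE. g (N x y) d * g (N x y) d / (g x x * g y y)) / g d d"
      by (simp add: SE1 sum_divide_distrib power2_eq_square)
    also have "\<dots> = 4 * lam + 2 * (1 / g d d)"
      using D_eq[OF SD_D[OF d] D_V[OF SD_D[OF d]]] JJ[OF d d] SD_nz[OF d] by (simp add: field_simps)
    finally show ?thesis .
  qed
  have eq: "(\<Sum>y\<in>SE. \<Sum>d\<in>SD. ?q d x y) = - 2 * lam - g (J x) (J x)" if x: "x \<in> SE" for x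
  proof -
    have "(\<Sum>y\<in>SE. \<Sum>d\<in>SD. ?q d x y) = (\<Sum>y\<in>SE. g (N x y) (N x y) / g y y)"
      by (simp add: SE1 N_expand power2_eq_square)
    then show ?thesis using E_eq[OF SE_E[OF x] SE_E[OF x]] SE1[OF x] by simp
  qed
  have q_sym: "?q d x y = ?q d y x" for d x y
    using N_anti[of x y] by (simp add: form_simps)
  have "(\<Sum>d\<in>SD. \<Sum>x\<in>SE. \<Sum>y\<in>SE. Q d x y) =
     (\<Sum>d\<in>SD. \<Sum>x\<in>SE. \<Sum>y\<in>SE. \<theta>D d * ?q d x y) + (\<Sum>d\<in>SD. \<Sum>x\<in>SE. \<Sum>y\<in>SE. \<theta>E x * ?q d x y)
     + (\<Sum>d\<in>SD. \<Sum>x\<in>SE. \<Sum>y\<in>SE. \<theta>E y * ?q d x y)"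
    unfolding Q_def sum.distrib[symmetric] by (intro sum.cong refl) (simp add: algebra_simps add_divide_distrib)
  also have "(\<Sum>d\<in>SD. \<Sum>x\<in>SE. \<Sum>y\<in>SE. \<theta>D d * ?q d x y) = (\<Sum>d\<in>SD. \<theta>D d * (4 * lam + 2 * (1 / g d d)))"
    unfolding sum_distrib_left[symmetric] using dq by (intro sum.cong) auto
  also have "(\<Sum>d\<in>SD. \<Sum>x\<in>SE. \<Sum>y\<in>SE. \<theta>E y * ?q d x y) = (\<Sum>d\<in>SD. \<Sum>x\<in>SE. \<Sum>y\<in>SE. \<theta>E x * ?q d x y)"
    by (subst sum.swap[of _ SE SE]) (subst q_sym, rule refl)
  also have "(\<Sum>d\<in>SD. \<Sum>x\<in>SE. \<Sum>y\<in>SE. \<theta>E x * ?q d x y) = (\<Sum>x\<in>SE. \<theta>E x * (\<Sum>y\<in>SE. \<Sum>d\<in>SD. ?q d x y))"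
    by (simp add: sum.swap[of _ SD] sum_distrib_left)
  also have "\<dots> = (\<Sum>x\<in>SE. \<theta>E x * (- 2 * lam - g (J x) (J x)))"
    using eq by (intro sum.cong) auto
  finally have "(\<Sum>d\<in>SD. \<Sum>x\<in>SE. \<Sum>y\<in>SE. Q d x y) =
     (\<Sum>d\<in>SD. 4 * lam + 2 * (1 / g d d)) - 3 * (4 * lam + 2 * (1 / g d0 d0))
     + 2 * ((\<Sum>x\<in>SE. - 2 * lam - g (J x) (J x)) - 3 * (- 2 * lam - 1 / g d0 d0))"
    unfolding weighted_sum_SD weighted_sum_SE JJ_norm[OF d0(1)] by simp
  also have "(\<Sum>d\<in>SD. 4 * lam + 2 * (1 / g d d)) = 4 * lam * card SD + 2 * (\<Sum>d\<in>SD. 1 / g d d)"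
    by (simp add: sum.distrib sum_distrib_left)
  also have "(\<Sum>x\<in>SE. - 2 * lam - g (J x) (J x)) = - 2 * lam * card SE - ((\<Sum>d\<in>SD. 1 / g d d) + rest)"
    unfolding sum_J_SE[symmetric] by (simp add: sum_subtractf)
  finally show ?thesis by (simp add: algebra_simps)
qed

text \<open>Once \<open>lam \<ge> 0\<close> is known from \<open>rest\<close>, the value in
  \<open>Q_sum\<close> is nonpositive, because injectivity of \<open>J\<close> gives
  \<open>card SD \<le> card SE\<close>. As a sum of nonnegative terms it must be 0, and every
  ingredient with it.\<close>

lemma lam_zero: "lam = 0" and rest_zero: "rest = 0"
  and Q_zero: "d \<in> SD \<Longrightarrow> x \<in> SE \<Longrightarrow> y \<in> SE \<Longrightarrow> Q d x y = 0"
proof -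
  have "0 < 8 * real (card SD) + 4 * card SE + 12" by (simp add: add_nonneg_pos)
  then have lam: "0 \<le> lam" using rest_nonneg rest_eq by (simp add: zero_le_mult_iff)
  have "card SD \<le> card SE"
    using card_mono[OF finite_SE J_SE] card_image[OF J_inj] by simp
  then have "4 * lam * (real (card SD) - real (card SE)) \<le> 0"
    using lam by (intro mult_nonneg_nonpos) auto
  moreover have s0: "0 \<le> (\<Sum>d\<in>SD. \<Sum>x\<in>SE. \<Sum>y\<in>SE. Q d x y)"
    by (intro sum_nonneg Q_nonneg)
  ultimately show r0: "rest = 0" using Q_sum rest_nonneg by linarith
  then show l0: "lam = 0" using rest_eq \<open>0 < 8 * real (card SD) + 4 * card SE + 12\<close> by simp
  have "(\<Sum>d\<in>SD. \<Sum>x\<in>SE. \<Sum>y\<in>SE. Q d x y) = 0" using Q_sum r0 l0 by simp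
  then show "Q d x y = 0" if "d \<in> SD" "x \<in> SE" "y \<in> SE"
    using that finite_SD finite_SE by (simp add: sum_nonneg_eq_0_iff sum_nonneg Q_nonneg)
qed

end

section \<open>Structure constants\<close>

context adapted_frame
begin

definition "K = SD - {d0}"
definition "E' = {x \<in> E. g x \<beta> = 0}"
definition "SE' = SE - {\<beta>}"
text \<open>The vector of \<open>E\<close> representing the functional
  \<open>\<lambda>y. g (N \<beta> y) k\<close>, that is, the adjoint of \<open>N \<beta>\<close>
  applied to \<open>k\<close>.\<close>

definition a where "a k = (\<Sum>b\<in>SE. g (N \<beta> b) k *\<^sub>R b)"

lemma K_SD: "k \<in> K \<Longrightarrow> k \<in> SD" and K_d0: "k \<in> K \<Longrightarrow> k \<noteq> d0" and finite_K: "finite K"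
  and SD_iff: "d \<in> SD \<longleftrightarrow> d = d0 \<or> d \<in> K"
  using finite_SD d0 by (auto simp: K_def)

lemma sum_SD: "(\<Sum>d\<in>SD. f d) = f d0 + (\<Sum>k\<in>K. f k)" for f :: "'a \<Rightarrow> 'b::comm_monoid_add"
  unfolding K_def by (rule sum.remove[OF finite_SD d0(1)])

lemma subspace_E': "subspace E'"
  using subspace_E by (auto simp: E'_def subspace_def form_simps)

lemma frame_E': "orth_frame g E' SE'" and SE'_1: "b \<in> SE' \<Longrightarrow> g b b = 1"
proof -
  have "x = (\<Sum>b\<in>SE'. (g x b / g b b) *\<^sub>R b)" if "x \<in> E'" for x
  proof -
    have "x = (\<Sum>b\<in>SE. (g x b / g b b) *\<^sub>R b)"
      using that by (intro orth_frame_expand[OF SE]) (simp add: E'_def)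
    also have "\<dots> = (g x \<beta> / g \<beta> \<beta>) *\<^sub>R \<beta> + (\<Sum>b\<in>SE'. (g x b / g b b) *\<^sub>R b)"
      unfolding SE'_def by (rule sum.remove[OF finite_SE beta_SE])
    also have "g x \<beta> = 0" using that by (simp add: E'_def)
    finally show ?thesis by simp
  qed
  moreover have "SE' \<subseteq> E'" using SE_E SE_orth beta_SE by (auto simp: SE'_def E'_def)
  ultimately show "orth_frame g E' SE'" unfolding orth_frame_def
    using finite_SE SE_orth SE_nz by (intro conjI ballI) (auto simp: SE'_def)
  show "b \<in> SE' \<Longrightarrow> g b b = 1" using SE1 by (simp add: SE'_def)
qed

lemma finite_SE': "finite SE'" and SE'_SE: "b \<in> SE' \<Longrightarrow> b \<in> SE" and SE'_beta: "b \<in> SE' \<Longrightarrow> b \<noteq> \<beta>"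
  and SE'_E': "b \<in> SE' \<Longrightarrow> b \<in> E'"
  using finite_SE frame_E' by (auto simp: SE'_def orth_frame_def)

lemma sum_SE: "(\<Sum>b\<in>SE. f b) = f \<beta> + (\<Sum>b\<in>SE'. f b)" for f :: "'a \<Rightarrow> real"
  unfolding SE'_def by (rule sum.remove[OF finite_SE beta_SE])

lemma J_E': assumes "k \<in> K" shows "J k \<in> E'"
  using J_D_E[OF SD_D] JJ[of k d0] K_SD[OF assms] K_d0[OF assms] d0 by (simp add: E'_def)

lemma E'_E: "x \<in> E' \<Longrightarrow> x \<in> E" and E'_beta: "x \<in> E' \<Longrightarrow> g x \<beta> = 0" and beta_E': "x \<in> E' \<Longrightarrow> g \<beta> x = 0"
  using sym by (auto simp: E'_def)

text \<open>Where the total weight is nonzero, \<open>Q_zero\<close> makes the structure constant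
  vanish; the weight is 3 here and -3 in \<open>N_beta_d0\<close>.\<close>

lemma N_K_frame:
  assumes "k \<in> K" "x \<in> SE'" "y \<in> SE'" shows "g (N x y) k = 0"
proof -
  have "Q k x y = 0" using Q_zero assms K_SD SE'_SE by blast
  moreover have "\<theta>D k + \<theta>E x + \<theta>E y = 3"
    using K_d0[OF assms(1)] SE'_beta[OF assms(2)] SE'_beta[OF assms(3)] by (simp add: \<theta>D_def \<theta>E_def)
  ultimately show ?thesis using SD_nz[OF K_SD[OF assms(1)]] by (simp add: Q_def)
qed

lemma linear_N_form: "linear (\<lambda>y. g (N x y) d)" "linear (\<lambda>x. g (N x y) d)"
  by (auto simp: linear_iff N_simps form_simps)

lemma bilinear_N_form: "bilinear (\<lambda>x y. g (N x y) d)"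
  by (simp add: bilinear_def linear_N_form)

lemma N_K:
  assumes "k \<in> K" "x \<in> E'" "y \<in> E'" shows "g (N x y) k = 0"
  using frame_bilinear[OF frame_E' SE'_1 bilinear_N_form assms(2,3), of k] N_K_frame[OF assms(1)] by simp

lemma N_beta_d0: "g (N \<beta> x) d0 = 0"
proof (rule linear_vanish_frame[OF frame_S linear_N_form(1)])
  fix b assume b: "b \<in> SD \<union> SE"
  show "g (N \<beta> b) d0 = 0"
  proof (cases "b \<in> SD \<or> b = \<beta>")
    case True then show ?thesis using SD_D by (auto simp: form_simps)
  next
    case False
    then have "Q d0 \<beta> b = 0" using Q_zero b d0 beta_SE by blast
    then show ?thesis using False SD_nz[OF d0(1)] by (simp add: Q_def \<theta>D_def \<theta>E_def)
  qed
qed (simp add: form_simps)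

lemma a_form: "g (a k) x = g (N \<beta> x) k" if "k \<in> K"
proof -
  have "linear (\<lambda>x. g (a k) x - g (N \<beta> x) k)"
    by (auto simp: linear_iff N_simps form_simps algebra_simps)
  then have "g (a k) x - g (N \<beta> x) k = 0"
  proof (rule linear_vanish_frame[OF frame_S])
    show "g (a k) z - g (N \<beta> z) k = 0"
      using E_V SE_E by (simp add: a_def sum_left form_simps)
    fix b assume b: "b \<in> SD \<union> SE"
    show "g (a k) b - g (N \<beta> b) k = 0"
    proof (cases "b \<in> SD")
      case True
      then show ?thesis using E_D[OF SE_E SD_D] SD_D by (simp add: a_def sum_left form_simps)
    next
      case False
      then have bE: "b \<in> SE" using b by simp
      have "g (a k) b = (\<Sum>c\<in>SE. g (N \<beta> c) k * g c b)" by (simp add: a_def sum_left form_simps)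
      also have "\<dots> = (\<Sum>c\<in>SE. if c = b then g (N \<beta> b) k else 0)"
        using SE_orth[OF _ bE] SE1[OF bE] by (intro sum.cong) auto
      also have "\<dots> = g (N \<beta> b) k" using bE finite_SE by simp
      finally show ?thesis by simp
    qed
  qed
  then show ?thesis by simp
qed

lemma a_E': assumes "k \<in> K" shows "a k \<in> E'"
proof -
  have "a k \<in> E" unfolding a_def
    using SE_E by (intro subspace_sum[OF subspace_E] subspace_mul[OF subspace_E]) auto
  then show ?thesis using a_form[OF assms, of \<beta>] by (simp add: E'_def form_simps)
qed

lemma sum_SE_N: "(\<Sum>b\<in>SE. \<Sum>c\<in>SE. g (N b c) k * g (N b c) l) =
   2 * (\<Sum>c\<in>SE'. g (N \<beta> c) k * g (N \<beta> c) l) + (\<Sum>b\<in>SE'. \<Sum>c\<in>SE'. g (N b c) k * g (N b c) l)"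
proof -
  have "g (N b \<beta>) k * g (N b \<beta>) l = g (N \<beta> b) k * g (N \<beta> b) l" for b
    using N_anti[of b \<beta>] by (simp add: form_simps)
  then show ?thesis by (simp add: sum_SE sum.distrib form_simps)
qed

lemma D_eq': "k \<in> SD \<Longrightarrow> l \<in> SD \<Longrightarrow>
  (\<Sum>b\<in>SE. \<Sum>c\<in>SE. g (N b c) k * g (N b c) l) = (if k = l then 2 else 0)"
  using D_eq[of k l] SD_D D_V lam_zero JJ[of k l] by (simp add: SE1)

text \<open>In the equation at \<open>(k, l)\<close> only pairs containing \<open>\<beta>\<close>
  contribute, each in two orders; this matches the factor 2 on the right of
  \<open>D_eq'\<close>.\<close>

lemma a_orth: assumes "k \<in> K" "l \<in> K" shows "g (a k) (a l) = (if k = l then 1 else 0)"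
proof -
  have "g (a k) (a l) = (\<Sum>c\<in>SE'. g (a k) c * g (a l) c / g c c)"
    by (rule frame_form[OF frame_E' a_E'[OF assms(1)]])
  also have "\<dots> = (\<Sum>c\<in>SE'. g (N \<beta> c) k * g (N \<beta> c) l)"
    using SE'_1 assms a_form by simp
  also have "2 * \<dots> = (if k = l then 2 else 0)"
    using sum_SE_N[of k l] D_eq'[of k l] assms K_SD N_K_frame by simp
  finally show ?thesis by (simp split: if_splits)
qed

text \<open>At \<open>d0\<close> only pairs avoiding \<open>\<beta>\<close> contribute, so the
  equation fixes the norm of the 2-form \<open>g (N _ _) d0\<close> on \<open>E'\<close>.\<close>

lemma sum_G: "(\<Sum>b\<in>SE'. \<Sum>c\<in>SE'. (g (N b c) d0)\<^sup>2) = 2"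
  using sum_SE_N[of d0 d0] D_eq'[of d0 d0] d0 N_beta_d0 by (simp add: power2_eq_square)

text \<open>Divided by the right-hand side, the positive numbers \<open>1 / g k k\<close> become the
  coefficients of a convex combination.\<close>

lemma sum_K: "(\<Sum>k\<in>K. 1 / g k k) = - 1 / g d0 d0"
  using sum_inverse lam_zero by (simp add: sum_SD)

lemma J_N: "J (N u v) = (\<Sum>d\<in>SD. (g (N u v) d / g d d) *\<^sub>R J d)"
  using orth_frame_linear[OF SD N_in_D J_linear] .

text \<open>The cocycle identity at \<open>(\<beta>, x, y)\<close>.\<close>

lemma G_expand:
  assumes x: "x \<in> E'" and y: "y \<in> E'"
  shows "- 1 / g d0 d0 * g (N x y) d0 = (\<Sum>k\<in>K. 1 / g k k * (g (a k) x * g (J k) y - g (a k) y * g (J k) x))"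
proof -
  have 1: "g (J (N \<beta> x)) y = (\<Sum>k\<in>K. 1 / g k k * (g (a k) x * g (J k) y))" for x y
    unfolding J_N sum_SD using N_beta_d0 a_form by (simp add: sum_left form_simps)
  have 2: "g (J (N x y)) \<beta> = g (N x y) d0 / g d0 d0"
    unfolding J_N sum_SD using N_K[OF _ x y] beta_beta by (simp add: sum_left form_simps)
  have "g (J (N \<beta> x)) y + g (J (N x y)) \<beta> + g (J (N y \<beta>)) x = 0" by (rule cocycle)
  moreover have "g (J (N y \<beta>)) x = - g (J (N \<beta> y)) x"
    using N_anti[of y \<beta>] by (simp add: J_simps form_simps)
  ultimately have "- (g (N x y) d0 / g d0 d0) = g (J (N \<beta> x)) y - g (J (N \<beta> y)) x" using 2 by linarith
  then show ?thesis unfolding 1 by (simp add: sum_subtractf[symmetric] right_diff_distrib)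
qed

text \<open>The wedge product of the 1-forms dual to \<open>a k\<close> and \<open>J k\<close>. In
  the double-sum norm its square is at most 2, the value in \<open>sum_G\<close>, since both vectors
  have length 1.\<close>

definition "\<omega> k x y = g (a k) x * g (J k) y - g (a k) y * g (J k) x"

lemma JK_unit: "k \<in> K \<Longrightarrow> g (J k) (J k) = 1"
  using JJ K_SD by simp

lemma contract_E':
  assumes "bilinear h" "x \<in> E'" "y \<in> E'"
  shows "(\<Sum>b\<in>SE'. \<Sum>c\<in>SE'. g x b * g y c * h b c) = h x y"
  using frame_bilinear[OF frame_E' SE'_1 assms] by simp

lemma contract_omega:
  assumes k: "k \<in> K" and h: "bilinear h" "\<And>x y. h x y = - h y x"
  shows "(\<Sum>b\<in>SE'. \<Sum>c\<in>SE'. h b c * \<omega> k b c) = 2 * h (a k) (J k)"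
proof -
  have "(\<Sum>b\<in>SE'. \<Sum>c\<in>SE'. h b c * \<omega> k b c) =
     (\<Sum>b\<in>SE'. \<Sum>c\<in>SE'. g (a k) b * g (J k) c * h b c) - (\<Sum>b\<in>SE'. \<Sum>c\<in>SE'. g (J k) b * g (a k) c * h b c)"
    unfolding sum_subtractf[symmetric] \<omega>_def by (intro sum.cong refl) (simp add: algebra_simps)
  also have "\<dots> = h (a k) (J k) - h (J k) (a k)"
    unfolding contract_E'[OF h(1) a_E'[OF k] J_E'[OF k]] contract_E'[OF h(1) J_E'[OF k] a_E'[OF k]] ..
  finally show ?thesis using h(2)[of "J k" "a k"] by simp
qed

lemma omega_bilin: "bilinear (\<omega> k)" and omega_anti: "\<omega> k x y = - \<omega> k y x"
  by (auto simp: \<omega>_def bilinear_def linear_iff form_simps algebra_simps)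

lemma G_anti: "g (N x y) d = - g (N y x) d"
  using N_anti[of x y] by (simp add: form_simps)

text \<open>A squared distance between two 2-forms. Its nonnegativity bounds
  \<open>g (N (a k) (J k)) d0\<close> by 1; when the bound is attained, both the distance and
  \<open>g (a k) (J k)\<close> must vanish.\<close>

lemma sum_G_omega:
  assumes k: "k \<in> K"
  shows "(\<Sum>b\<in>SE'. \<Sum>c\<in>SE'. (g (N b c) d0 - \<omega> k b c)\<^sup>2) = 4 - 4 * g (N (a k) (J k)) d0 - 2 * (g (a k) (J k))\<^sup>2"
proof -
  have "(\<Sum>b\<in>SE'. \<Sum>c\<in>SE'. (g (N b c) d0 - \<omega> k b c)\<^sup>2) =
    (\<Sum>b\<in>SE'. \<Sum>c\<in>SE'. (g (N b c) d0)\<^sup>2) - 2 * (\<Sum>b\<in>SE'. \<Sum>c\<in>SE'. g (N b c) d0 * \<omega> k b c)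
    + (\<Sum>b\<in>SE'. \<Sum>c\<in>SE'. \<omega> k b c * \<omega> k b c)"
    unfolding sum_distrib_left sum_subtractf[symmetric] sum.distrib[symmetric]
    by (intro sum.cong refl) (simp add: power2_eq_square algebra_simps)
  also have "\<dots> = 2 - 4 * g (N (a k) (J k)) d0 + 2 * \<omega> k (a k) (J k)"
    unfolding sum_G contract_omega[OF k bilinear_N_form G_anti] contract_omega[OF k omega_bilin omega_anti] by simp
  also have "\<omega> k (a k) (J k) = 1 - (g (a k) (J k))\<^sup>2"
    using a_orth[OF k k] JK_unit[OF k] sym[of "J k" "a k"] by (simp add: \<omega>_def power2_eq_square)
  finally show ?thesis by simp
qed

lemma G_a_le: assumes "k \<in> K" shows "g (N (a k) (J k)) d0 \<le> 1"
proof -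
  have "0 \<le> (\<Sum>b\<in>SE'. \<Sum>c\<in>SE'. (g (N b c) d0 - \<omega> k b c)\<^sup>2)" by (intro sum_nonneg) simp
  then show ?thesis unfolding sum_G_omega[OF assms] using zero_le_power2[of "g (a k) (J k)"] by linarith
qed

lemma K_pos: "k \<in> K \<Longrightarrow> 0 < 1 / g k k"
  using SD_pos K_SD K_d0 by simp

text \<open>By \<open>G_expand\<close>, the form \<open>G = g (N _ _) d0\<close> on \<open>E'\<close> is a convex combination of the forms
  \<open>\<omega> k\<close>, whose norms do not exceed that of \<open>G\<close>; hence all of them equal \<open>G\<close>.\<close>

lemma G_a: assumes "k \<in> K" shows "g (N (a k) (J k)) d0 = 1"
proof -
  let ?C = "- 1 / g d0 d0"
  have "?C * 2 = (\<Sum>b\<in>SE'. \<Sum>c\<in>SE'. g (N b c) d0 * (?C * g (N b c) d0))"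
    unfolding sum_G[symmetric] by (simp add: sum_distrib_left power2_eq_square mult_ac)
  also have "\<dots> = (\<Sum>b\<in>SE'. \<Sum>c\<in>SE'. g (N b c) d0 * (\<Sum>k\<in>K. 1 / g k k * \<omega> k b c))"
    using G_expand SE'_E' by (intro sum.cong refl) (simp only: \<omega>_def)
  also have "\<dots> = (\<Sum>b\<in>SE'. \<Sum>c\<in>SE'. \<Sum>k\<in>K. 1 / g k k * (g (N b c) d0 * \<omega> k b c))"
    by (simp add: sum_distrib_left mult_ac)
  also have "\<dots> = (\<Sum>k\<in>K. 1 / g k k * (\<Sum>b\<in>SE'. \<Sum>c\<in>SE'. g (N b c) d0 * \<omega> k b c))"
    by (simp add: sum.swap[of _ K] sum_distrib_left)
  also have "\<dots> = (\<Sum>k\<in>K. 1 / g k k * (2 * g (N (a k) (J k)) d0))"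
    using contract_omega[OF _ bilinear_N_form G_anti] by (intro sum.cong) auto
  finally have "(\<Sum>k\<in>K. 1 / g k k * (2 * g (N (a k) (J k)) d0)) = (\<Sum>k\<in>K. 1 / g k k * 2)"
    unfolding sum_K[symmetric] by (simp add: sum_distrib_right)
  moreover have "(\<Sum>k\<in>K. 1 / g k k * (1 - g (N (a k) (J k)) d0)) =
      1/2 * ((\<Sum>k\<in>K. 1 / g k k * 2) - (\<Sum>k\<in>K. 1 / g k k * (2 * g (N (a k) (J k)) d0)))"
    unfolding sum_subtractf[symmetric] sum_distrib_left
    by (intro sum.cong refl) (simp add: right_diff_distrib)
  ultimately have "(\<Sum>k\<in>K. 1 / g k k * (1 - g (N (a k) (J k)) d0)) = 0" by simp
  moreover have "0 \<le> 1 / g k k * (1 - g (N (a k) (J k)) d0)" if "k \<in> K" for k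
    using K_pos[OF that] G_a_le[OF that] by (intro mult_nonneg_nonneg) auto
  ultimately have "1 / g k k * (1 - g (N (a k) (J k)) d0) = 0"
    using sum_nonneg_eq_0_iff[OF finite_K] assms by (metis (no_types, lifting))
  then show ?thesis using K_pos[OF assms] by simp
qed

lemma a_J_orth: "g (a k) (J k) = 0" and G_omega: "\<And>x y. x \<in> E' \<Longrightarrow> y \<in> E' \<Longrightarrow> g (N x y) d0 = \<omega> k x y"
  if k: "k \<in> K"
proof -
  let ?S = "\<Sum>b\<in>SE'. \<Sum>c\<in>SE'. (g (N b c) d0 - \<omega> k b c)\<^sup>2"
  have S0: "0 \<le> ?S" by (intro sum_nonneg) simp
  have S: "?S = - 2 * (g (a k) (J k))\<^sup>2" using sum_G_omega[OF k] G_a[OF k] by simp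
  then show "g (a k) (J k) = 0" using S0 by simp
  then have "?S = 0" using S by simp
  then have "\<forall>b\<in>SE'. \<forall>c\<in>SE'. g (N b c) d0 = \<omega> k b c"
    using finite_SE' by (simp add: sum_nonneg_eq_0_iff sum_nonneg)
  then have eq: "\<And>b c. b \<in> SE' \<Longrightarrow> c \<in> SE' \<Longrightarrow> g (N b c) d0 = \<omega> k b c" by blast
  show "g (N x y) d0 = \<omega> k x y" if xy: "x \<in> E'" "y \<in> E'" for x y
  proof -
    have "g (N x y) d0 = (\<Sum>b\<in>SE'. \<Sum>c\<in>SE'. g x b * g y c * g (N b c) d0)"
      using contract_E'[OF bilinear_N_form xy] by simp
    also have "\<dots> = (\<Sum>b\<in>SE'. \<Sum>c\<in>SE'. g x b * g y c * \<omega> k b c)" using eq by simp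
    also have "\<dots> = \<omega> k x y" by (rule contract_E'[OF omega_bilin xy])
    finally show ?thesis .
  qed
qed

text \<open>As \<open>rest = 0\<close>, a frame vector \<open>b\<close> of \<open>E\<close> outside
  \<open>J D\<close> has \<open>J b\<close> null; it is also orthogonal to the timelike
  \<open>d0\<close>, hence zero.\<close>

lemma J_zero: assumes x: "x \<in> E" and o: "\<And>d. d \<in> SD \<Longrightarrow> g x (J d) = 0" shows "J x = 0"
proof -
  have "J x = (\<Sum>b\<in>SE. (g x b / g b b) *\<^sub>R J b)" by (rule orth_frame_linear[OF SE x J_linear])
  also have "\<dots> = 0"
  proof (rule sum.neutral, rule ballI)
    fix b assume b: "b \<in> SE"
    show "(g x b / g b b) *\<^sub>R J b = 0"
    proof (cases "b \<in> J ` SD")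
      case True then show ?thesis using o by auto
    next
      case False
      then have bb: "b \<in> SE - J ` SD" using b by simp
      have "g (J b) (J b) = 0"
        using rest_zero sum_nonneg_eq_0_iff[of "SE - J ` SD" "\<lambda>x. g (J x) (J x)"] J_rest_nonneg bb finite_SE
        by (simp add: rest_def)
      moreover have "g (J b) d0 = 0"
        using J_skew[of b d0] SE_orth[of b \<beta>] bb beta_SE d0 by auto
      ultimately have "J b = 0" using timelike_orth_zero[OF d0(2), of "J b"] by simp
      then show ?thesis by simp
    qed
  qed
  finally show ?thesis .
qed

text \<open>All \<open>\<omega> l\<close> are the same form on \<open>E'\<close>, so orthogonality
  to \<open>a k\<close> and \<open>J k\<close> spreads to every \<open>a l\<close> and
  \<open>J l\<close>. Then \<open>N x\<close> and \<open>J x\<close> vanish and \<open>x\<close> is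
  central. Consequently \<open>E'\<close> is a plane.\<close>

lemma E'_zero:
  assumes k: "k \<in> K" and x: "x \<in> E'" and o: "g (a k) x = 0" "g (J k) x = 0"
  shows "x = 0"
proof -
  have G0: "g (N x y) d0 = 0" if "y \<in> E'" for y
    using G_omega[OF k x that] o by (simp add: \<omega>_def)
  have al: "g (a l) x = 0" and Jl: "g (J l) x = 0" if l: "l \<in> K" for l
  proof -
    have "\<omega> l x (J l) = 0" "\<omega> l x (a l) = 0"
      using G0 G_omega[OF l x] J_E'[OF l] a_E'[OF l] by simp_all
    then show "g (a l) x = 0" "g (J l) x = 0"
      using a_J_orth[OF l] a_orth[OF l l] JK_unit[OF l] by (simp_all add: \<omega>_def)
  qed
  have "J x = 0"
  proof (rule J_zero[OF E'_E[OF x]])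
    fix d assume "d \<in> SD"
    then show "g x (J d) = 0" using E'_beta[OF x] Jl sym[of x "J d"] by (auto simp: SD_iff)
  qed
  moreover have Nb: "N x b = 0" if b: "b \<in> SE" for b
  proof -
    have "g (N x b) d = 0" if d: "d \<in> SD" for d
    proof (cases "b = \<beta>")
      case True
      then show ?thesis using d N_beta_d0[of x] a_form[of d x] al G_anti[of x \<beta> d] by (auto simp: SD_iff)
    next
      case False
      then have "b \<in> SE'" using b by (simp add: SE'_def)
      then show ?thesis using d G0 N_K[OF _ x] SE'_E' by (auto simp: SD_iff)
    qed
    then have "(\<Sum>d\<in>SD. (g (N x b) d / g d d) *\<^sub>R d) = 0" by simp
    then show ?thesis using orth_frame_expand[OF SD, of "N x b"] by simp
  qed
  moreover have "N x y = 0" for y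
    by (rule linear_vanish_frame[OF frame_S N_linear_right]) (use Nb SD_D in auto)
  ultimately show ?thesis using center_zero[OF E_V[OF E'_E[OF x]]] by blast
qed

lemma E'_expand:
  assumes k: "k \<in> K" and x: "x \<in> E'"
  shows "x = g x (a k) *\<^sub>R a k + g x (J k) *\<^sub>R J k"
proof -
  let ?y = "x - (g x (a k) *\<^sub>R a k + g x (J k) *\<^sub>R J k)"
  have "?y \<in> E'" using x a_E'[OF k] J_E'[OF k]
    by (intro subspace_diff[OF subspace_E'] subspace_add[OF subspace_E'] subspace_mul[OF subspace_E'])
  moreover have "g (a k) ?y = 0" "g (J k) ?y = 0"
    using a_J_orth[OF k] sym[of "J k" "a k"] a_orth[OF k k] JK_unit[OF k] sym[of x]
    by (simp_all add: form_simps)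
  ultimately have "?y = 0" using E'_zero[OF k] by blast
  then show ?thesis by simp
qed

text \<open>In the plane \<open>E'\<close>, the vector \<open>a l\<close> is orthogonal to
  \<open>a k\<close> and \<open>J l\<close> to \<open>J k\<close>, so each is a multiple of the
  other basis vector. Equality of the area forms \<open>\<omega> l\<close> and
  \<open>\<omega> k\<close> makes the two factors opposite signs.\<close>

lemma K_pair:
  assumes k: "k \<in> K" and l: "l \<in> K" and kl: "k \<noteq> l"
  shows "\<exists>e::real. e * e = 1 \<and> a l = e *\<^sub>R J k \<and> J l = - e *\<^sub>R a k"
proof -
  have "g (a l) (a k) = 0" using a_orth[OF l k] kl by simp
  then have al: "a l = g (a l) (J k) *\<^sub>R J k" using E'_expand[OF k a_E'[OF l]] by simp
  have "g (J l) (J k) = 0" using JJ[OF K_SD[OF l] K_SD[OF k]] kl by simp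
  then have Jl: "J l = g (J l) (a k) *\<^sub>R a k" using E'_expand[OF k J_E'[OF l]] by simp
  define e where "e = g (a l) (J k)"
  define e' where "e' = g (J l) (a k)"
  have e: "a l = e *\<^sub>R J k" "J l = e' *\<^sub>R a k" using al Jl by (simp_all add: e_def e'_def)
  have "g (a l) (a l) = 1" using a_orth[OF l l] by simp
  then have ee: "e * e = 1" using JK_unit[OF k] by (simp add: e form_simps)
  have "\<omega> k (a l) (J l) = 1" using G_a[OF l] G_omega[OF k a_E'[OF l] J_E'[OF l]] by simp
  then have "e * e' = - 1"
    using a_J_orth[OF k] a_orth[OF k k] JK_unit[OF k] by (simp add: \<omega>_def e form_simps mult.commute)
  then have "e * (e + e') = 0" using ee by (simp add: distrib_left)
  then have "e' = - e" using ee by auto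
  then show ?thesis using e ee by auto
qed

text \<open>The vectors \<open>a k\<close> are orthonormal in a plane, which leaves room for two. At
  least one exists because the sum in \<open>sum_K\<close> is nonzero.\<close>

lemma K_cases: "(\<exists>k. K = {k}) \<or> (\<exists>k l. k \<noteq> l \<and> K = {k, l})"
proof -
  have "K \<noteq> {}" using sum_K d0 by auto
  then obtain k where k: "k \<in> K" by blast
  have no3: False if "l \<in> K" "m \<in> K" "k \<noteq> l" "k \<noteq> m" "l \<noteq> m" for l m
  proof -
    obtain e where e: "e * e = 1" "a l = e *\<^sub>R J k" using K_pair[OF k \<open>l \<in> K\<close> \<open>k \<noteq> l\<close>] by blast
    obtain f where f: "f * f = 1" "a m = f *\<^sub>R J k" using K_pair[OF k \<open>m \<in> K\<close> \<open>k \<noteq> m\<close>] by blast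
    have "e * f = 0" using a_orth[OF \<open>l \<in> K\<close> \<open>m \<in> K\<close>] \<open>l \<noteq> m\<close> JK_unit[OF k] by (auto simp: e f form_simps)
    then show False using e(1) f(1) by auto
  qed
  show ?thesis
  proof (cases "K = {k}")
    case False
    then obtain l where l: "l \<in> K" "k \<noteq> l" using k by blast
    then have "K = {k, l}" using no3 k by blast
    then show ?thesis using l by blast
  qed blast
qed

end

section \<open>The two families of bases\<close>

text \<open>A biorthogonal system whose second half separates points yields independence, spanning
  and the dimension at once, from a finite table of values of \<open>g\<close>.\<close>

lemma (in symmetric_form) basis_from_dual:
  assumes dual: "\<And>i j. i \<in> {1..n} \<Longrightarrow> j \<in> {1..n} \<Longrightarrow> g (f i) (h j) = (if i = j then 1 else 0)"
    and total: "\<And>x. (\<And>j. j \<in> {1..n} \<Longrightarrow> g x (h j) = 0) \<Longrightarrow> x = 0"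
  shows "is_basis_n n f" and "DIM('a) = n"
proof -
  have coeff: "g (\<Sum>i\<in>{1..n}. u i *\<^sub>R f i) (h j) = u j" if j: "j \<in> {1..n}" for u j
  proof -
    have "g (\<Sum>i\<in>{1..n}. u i *\<^sub>R f i) (h j) = (\<Sum>i\<in>{1..n}. if i = j then u j else 0)"
      unfolding sum_left using dual j by (intro sum.cong) (auto simp: form_simps)
    then show ?thesis using j by simp
  qed
  have inj: "inj_on f {1..n}"
    by (rule inj_onI) (metis dual zero_neq_one)
  have ind: "independent (f ` {1..n})"
  proof (rule independent_if_scalars_zero)
    fix u x assume 0: "(\<Sum>x\<in>f ` {1..n}. u x *\<^sub>R x) = 0" and x: "x \<in> f ` {1..n}"
    then obtain j where j: "j \<in> {1..n}" "x = f j" by blast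
    have "(\<Sum>i\<in>{1..n}. u (f i) *\<^sub>R f i) = 0" using 0 unfolding sum.reindex[OF inj] o_def .
    then show "u x = 0" using coeff[OF j(1), of "\<lambda>i. u (f i)"] j(2) by (simp add: form_simps)
  qed simp
  have "x \<in> span (f ` {1..n})" for x
  proof -
    define w where "w = (\<Sum>i\<in>{1..n}. g x (h i) *\<^sub>R f i)"
    have "x - w = 0"
    proof (rule total)
      fix j assume "j \<in> {1..n}"
      from coeff[OF this, of "\<lambda>i. g x (h i)"] show "g (x - w) (h j) = 0"
        by (simp only: w_def bilinear_lsub[OF bilin] diff_self)
    qed
    then have "x = w" by simp
    also have "w \<in> span (f ` {1..n})"
      unfolding w_def by (intro span_sum span_scale span_base) auto
    finally show ?thesis .
  qed
  then have sp: "span (f ` {1..n}) = UNIV" by blast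
  show "is_basis_n n f" using inj ind sp by (simp add: is_basis_n_def)
  have "DIM('a) = dim (span (f ` {1..n}))" by (simp only: sp dim_UNIV)
  also have "\<dots> = card (f ` {1..n})" by (simp only: dim_span dim_eq_card_independent[OF ind])
  finally show "DIM('a) = n" using card_image[OF inj] by simp
qed

lemma interval_6: "{1..6::nat} = {1, 2, 3, 4, 5, 6}" and interval_7: "{1..7::nat} = {1, 2, 3, 4, 5, 6, 7}"
  by auto

context adapted_frame
begin

lemma total_zero:
  assumes "g x z = 0" "\<And>d. d \<in> SD \<Longrightarrow> g x d = 0" "g x \<beta> = 0"
    and "k \<in> K" "g x (a k) = 0" "g x (J k) = 0"
  shows "x = 0"
proof -
  have "g x (N u v) = 0" for u v
    using frame_form[OF SD N_in_D, of u v x] assms(2) sym[of x "N u v"] by simp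
  then have "x \<in> E'" using EI assms(1,3) by (simp add: E'_def)
  then show ?thesis using E'_expand[OF assms(4), of x] assms(5,6) by simp
qed

lemma N_expand_vec: "N u v = (\<Sum>d\<in>SD. (g (N u v) d / g d d) *\<^sub>R d)"
  by (rule orth_frame_expand[OF SD]) simp

lemma form_E_D: "x \<in> E \<Longrightarrow> d \<in> SD \<Longrightarrow> g x d = 0" "x \<in> E \<Longrightarrow> d \<in> SD \<Longrightarrow> g d x = 0"
  using E_D D_E SD_D by auto

lemma form_z: "x \<in> E \<Longrightarrow> g z x = 0" "d \<in> SD \<Longrightarrow> g z d = 0" "d \<in> SD \<Longrightarrow> g d z = 0"
  using E_V D_V SD_D sym[of z] by auto


lemma a_E: "k \<in> K \<Longrightarrow> a k \<in> E"
  using E'_E[OF a_E'] .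

lemma basis_6:
  assumes K: "K = {k}"
    and B: "\<And>x y. B x y = N x y + g (J x) y *\<^sub>R z"
  shows "DIM('a) = 6 \<and> (\<exists>(f::nat \<Rightarrow> 'a) (\<alpha>::real). \<alpha> \<noteq> 0 \<and> is_basis_n 6 f \<and>
          (\<forall>i\<in>{1..6}. \<forall>j\<in>{1..6}. B (f i) (f j) = br6 f i j \<and> g (f i) (f j) = met6 \<alpha> i j))"
proof -
  have k: "k \<in> K" using K by simp
  have SDs: "d0 \<in> SD" "k \<in> SD" "k \<noteq> d0" using k K_SD K_d0 d0 by auto
  define q where "q = 1 / g k k"
  have q: "0 < q" using K_pos[OF k] by (simp add: q_def)
  have gk: "g k k = 1 / q" by (simp add: q_def)
  have "q = - 1 / g d0 d0" using sum_K by (simp add: K q_def)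
  then have gd: "g d0 d0 = - 1 / q" by simp
  define A b c where "A = a k" and "b = J k" and "c = J d0"
  have inE: "A \<in> E" "b \<in> E" "c \<in> E"
    using a_E[OF k] E'_E[OF J_E'[OF k]] beta_E by (simp_all add: A_def b_def c_def)
  have inE': "A \<in> E'" "b \<in> E'" using a_E'[OF k] J_E'[OF k] by (simp_all add: A_def b_def)
  have gA: "g A A = 1" "g b b = 1" "g c c = 1" "g A b = 0" "g b A = 0" "g A c = 0" "g c A = 0" "g b c = 0" "g c b = 0"
    using a_orth[OF k k] JK_unit[OF k] beta_beta a_J_orth[OF k] sym[of b A] E'_beta inE' beta_E'
    by (simp_all add: A_def b_def c_def)
  have gt: "g z z = 1" "g d0 k = 0" "g k d0 = 0"
    using gzz zeta_one SD_orth SDs by auto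
  note gz = E_V[OF inE(1)] E_V[OF inE(2)] E_V[OF inE(3)] form_z(1)[OF inE(1)] form_z(1)[OF inE(2)] form_z(1)[OF inE(3)]
    form_z(2,3)[OF SDs(1)] form_z(2,3)[OF SDs(2)]
  note gE = form_E_D[OF inE(1) SDs(1)] form_E_D[OF inE(1) SDs(2)] form_E_D[OF inE(2) SDs(1)]
    form_E_D[OF inE(2) SDs(2)] form_E_D[OF inE(3) SDs(1)] form_E_D[OF inE(3) SDs(2)]
  have Nx: "N u v = (g (N u v) d0 / g d0 d0) *\<^sub>R d0 + (g (N u v) k / g k k) *\<^sub>R k" for u v
    using N_expand_vec[of u v] by (simp add: sum_SD K)
  have NcA: "N c A = q *\<^sub>R k"
    using Nx[of c A] N_beta_d0[of A] a_form[OF k, of A] gA gk by (simp add: A_def[symmetric] c_def[symmetric])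
  have Ncb: "N c b = 0"
    using Nx[of c b] N_beta_d0[of b] a_form[OF k, of b] gA by (simp add: A_def[symmetric] c_def[symmetric])
  have NAb: "N A b = - q *\<^sub>R d0"
    using Nx[of A b] N_K[OF k inE'] G_a[OF k] gd by (simp add: A_def b_def)
  have Nt: "N A c = - q *\<^sub>R k" "N b c = 0" "N b A = q *\<^sub>R d0"
    using N_anti[of A c] N_anti[of b c] N_anti[of b A] NcA Ncb NAb by simp_all
  have Nd: "N d0 x = 0" "N x d0 = 0" "N k x = 0" "N x k = 0" for x
    using D_central SD_D SDs by auto
  have JA: "J A = 0"
    by (rule J_zero[OF inE(1)]) (use gA in \<open>auto simp: SD_iff K b_def c_def\<close>)
  have Jt: "J b = - q *\<^sub>R k" "J c = q *\<^sub>R d0" "J k = b" "J d0 = c"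
    using JJ_D[OF SDs(2)] JJ_D[OF SDs(1)] gk gd by (simp_all add: b_def c_def)
  \<comment> \<open>The norms of \<open>k\<close> and \<open>d0\<close> are opposite, so sums and
    differences turn them into the null pair \<open>f 4\<close>, \<open>f 5\<close>. The same change
    of \<open>b\<close> and \<open>c\<close> makes these the brackets of \<open>A\<close> with
    \<open>f 2\<close> and \<open>f 3\<close>. Finally \<open>f 6\<close> is the bracket of
    \<open>f 2\<close> and \<open>f 4\<close>, and \<alpha> will be \<open>sqrt q\<close>.\<close>
  define f :: "nat \<Rightarrow> 'a" where "f = (\<lambda>i. [0, A, c + b, b - c, - q *\<^sub>R (k + d0), q *\<^sub>R (k - d0), (2 * q) *\<^sub>R z] ! i)"
  define h :: "nat \<Rightarrow> 'a" where "h = (\<lambda>i. [0, A, (1/2) *\<^sub>R (c + b), (1/2) *\<^sub>R (b - c),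
     - (1/2) *\<^sub>R (k - d0), (1/2) *\<^sub>R (k + d0), (1 / (2 * q)) *\<^sub>R z] ! i)"
  have f: "f 1 = A" "f 2 = c + b" "f 3 = b - c" "f 4 = - q *\<^sub>R (k + d0)" "f 5 = q *\<^sub>R (k - d0)" "f 6 = (2 * q) *\<^sub>R z"
    by (simp_all add: f_def)
  have h: "h 1 = A" "h 2 = (1/2) *\<^sub>R (c + b)" "h 3 = (1/2) *\<^sub>R (b - c)" "h 4 = - (1/2) *\<^sub>R (k - d0)"
    "h 5 = (1/2) *\<^sub>R (k + d0)" "h 6 = (1 / (2 * q)) *\<^sub>R z"
    by (simp_all add: h_def)
  note tab = form_simps gA gt gz gE gk gd
  have "\<forall>i\<in>{1..6}. \<forall>j\<in>{1..6}. g (f i) (h j) = (if i = j then 1 else 0)"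
    using q unfolding interval_6 by (simp add: f h tab del: One_nat_def)
  then have dual: "g (f i) (h j) = (if i = j then 1 else 0)" if "i \<in> {1..6}" "j \<in> {1..6}" for i j
    using that by blast
  have total: "x = 0" if x: "\<And>j. j \<in> {1..6} \<Longrightarrow> g x (h j) = 0" for x
  proof -
    have xs: "g x (h 1) = 0" "g x (h 2) = 0" "g x (h 3) = 0" "g x (h 4) = 0" "g x (h 5) = 0" "g x (h 6) = 0"
      by (simp_all add: x)
    then have "g x A = 0" "g x c + g x b = 0" "g x b - g x c = 0" "g x k - g x d0 = 0" "g x k + g x d0 = 0" "g x z = 0"
      using q by (simp_all add: h form_simps del: One_nat_def)
    then show ?thesis
      using k by (intro total_zero[of x k]) (auto simp: SD_iff K A_def b_def c_def)
  qed
  have al: "sqrt q \<noteq> 0" "(sqrt q)^2 = q" "(sqrt q)^4 = q * q"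
    using q by (simp_all add: power4_eq_xxxx)
  have "\<forall>i\<in>{1..6}. \<forall>j\<in>{1..6}. g (f i) (f j) = met6 (sqrt q) i j"
    using q unfolding interval_6 by (simp add: f tab met6_def al field_simps del: One_nat_def)
  moreover have "\<forall>i\<in>{1..6}. \<forall>j\<in>{1..6}. B (f i) (f j) = br6 f i j"
    using q unfolding interval_6
    by (simp add: f tab br6_def B N_simps J_simps NcA Ncb NAb Nt Nd JA Jt scaleR_right_distrib
        scaleR_right_diff_distrib del: One_nat_def)
  ultimately show ?thesis
    using basis_from_dual[OF dual total] al(1) by blast
qed


lemma basis_7:
  assumes K: "K = {k, l}" and kl: "k \<noteq> l"
    and B: "\<And>x y. B x y = N x y + g (J x) y *\<^sub>R z"
  shows "DIM('a) = 7 \<and> (\<exists>(f::nat \<Rightarrow> 'a) (r::real) (m::real). 0 < r \<and> r < 1 \<and> 0 < m \<and> is_basis_n 7 f \<and>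
          (\<forall>i\<in>{1..7}. \<forall>j\<in>{1..7}. B (f i) (f j) = br7 r f i j \<and> g (f i) (f j) = met7 r m i j))"
proof -
  have k: "k \<in> K" "l \<in> K" using K by auto
  have SDs: "d0 \<in> SD" "k \<in> SD" "l \<in> SD" "k \<noteq> d0" "l \<noteq> d0" using k K_SD K_d0 d0 by auto
  define q1 q2 where "q1 = 1 / g k k" and "q2 = 1 / g l l"
  have q: "0 < q1" "0 < q2" using K_pos[OF k(1)] K_pos[OF k(2)] by (simp_all add: q1_def q2_def)
  define q0 where "q0 = q1 + q2"
  have q0: "0 < q0" using q by (simp add: q0_def)
  have gk: "g k k = 1 / q1" "g l l = 1 / q2" by (simp_all add: q1_def q2_def)
  have "q0 = - 1 / g d0 d0" using sum_K kl by (simp add: K q1_def q2_def q0_def)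
  then have gd: "g d0 d0 = - 1 / q0" by simp
  obtain e where e: "e * e = 1" "a l = e *\<^sub>R J k" "J l = - e *\<^sub>R a k" using K_pair[OF k kl] by blast
  define b c w where "b = J k" and "c = J l" and "w = J d0"
  have ee: "e * (e * x) = x" for x using e(1) by (metis mult.assoc mult_1)
  have al: "a l = e *\<^sub>R b" by (simp add: e b_def)
  have ak: "a k = - e *\<^sub>R c" by (simp add: c_def e(3) e(1))
  have inE': "b \<in> E'" "c \<in> E'" using J_E' k by (simp_all add: b_def c_def)
  have inE: "b \<in> E" "c \<in> E" "w \<in> E" using E'_E inE' beta_E by (simp_all add: w_def)
  have gA: "g b b = 1" "g c c = 1" "g w w = 1" "g b c = 0" "g c b = 0" "g b w = 0" "g w b = 0" "g c w = 0" "g w c = 0"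
    using JJ SDs kl by (simp_all add: b_def c_def w_def)
  have gt: "g z z = 1" "g d0 k = 0" "g k d0 = 0" "g d0 l = 0" "g l d0 = 0" "g k l = 0" "g l k = 0"
    using gzz zeta_one SD_orth SDs kl by auto
  note gz = E_V[OF inE(1)] E_V[OF inE(2)] E_V[OF inE(3)] form_z(1)[OF inE(1)] form_z(1)[OF inE(2)] form_z(1)[OF inE(3)]
    form_z(2,3)[OF SDs(1)] form_z(2,3)[OF SDs(2)] form_z(2,3)[OF SDs(3)]
  note gE = form_E_D[OF inE(1) SDs(1)] form_E_D[OF inE(1) SDs(2)] form_E_D[OF inE(1) SDs(3)]
    form_E_D[OF inE(2) SDs(1)] form_E_D[OF inE(2) SDs(2)] form_E_D[OF inE(2) SDs(3)]
    form_E_D[OF inE(3) SDs(1)] form_E_D[OF inE(3) SDs(2)] form_E_D[OF inE(3) SDs(3)]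
  have Nx: "N u v = (g (N u v) d0 / g d0 d0) *\<^sub>R d0 + ((g (N u v) k / g k k) *\<^sub>R k + (g (N u v) l / g l l) *\<^sub>R l)" for u v
    using N_expand_vec[of u v] kl by (simp add: sum_SD K)
  have af: "g (N w x) k = - e * g c x" "g (N w x) l = e * g b x" for x
    using a_form[OF k(1), of x] a_form[OF k(2), of x] by (simp_all add: ak al w_def form_simps)
  have w0: "g (N w x) d0 = 0" for x using N_beta_d0 by (simp add: w_def)
  have Nwb: "N w b = (e * q2) *\<^sub>R l" and Nwc: "N w c = - (e * q1) *\<^sub>R k"
    using Nx[of w b] Nx[of w c] gk gA by (simp_all add: af w0)
  have "g (N b c) d0 = e"
    using G_omega[OF k(1) inE'] gA by (simp add: \<omega>_def ak b_def[symmetric] form_simps)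
  then have Nbc: "N b c = - (e * q0) *\<^sub>R d0"
    using Nx[of b c] N_K[OF k(1) inE'] N_K[OF k(2) inE'] gd by simp
  have Nt: "N b w = - (e * q2) *\<^sub>R l" "N c w = (e * q1) *\<^sub>R k" "N c b = (e * q0) *\<^sub>R d0"
    using N_anti[of b w] N_anti[of c w] N_anti[of c b] Nwb Nwc Nbc by simp_all
  have Nd: "N d0 x = 0" "N x d0 = 0" "N k x = 0" "N x k = 0" "N l x = 0" "N x l = 0" for x
    using D_central SD_D SDs by auto
  have Jt: "J b = - q1 *\<^sub>R k" "J c = - q2 *\<^sub>R l" "J w = q0 *\<^sub>R d0" "J k = b" "J l = c" "J d0 = w"
    using JJ_D[OF SDs(2)] JJ_D[OF SDs(1)] JJ_D[OF SDs(3)] gk gd by (simp_all add: b_def c_def w_def)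
  \<comment> \<open>The share of \<open>l\<close> in \<open>q0 = q1 + q2\<close>; both summands are
    positive, which puts it strictly between 0 and 1. The second parameter of the family is
    \<open>q0\<close>.\<close>
  define r where "r = q2 / q0"
  have r: "0 < r" "r < 1" "q0 * r = q2" "q0 * (1 - r) = q1"
    using q q0 by (auto simp: r_def q0_def field_simps)
  \<comment> \<open>\<open>f 4\<close>, \<open>f 5\<close> and \<open>f 6\<close> are the brackets
    of \<open>w\<close>, \<open>b\<close>, \<open>c\<close>, and \<open>f 7\<close> is the bracket
    of \<open>f 4\<close> and \<open>f 1\<close>. The sign \<open>e\<close> left open by
    \<open>K_pair\<close> is absorbed into these four vectors.\<close>
  define f :: "nat \<Rightarrow> 'a" where "f = (\<lambda>i. [0, w, b, c, - (e * q0) *\<^sub>R d0, (e * q2) *\<^sub>R l, - (e * q1) *\<^sub>R k, - (e * q0) *\<^sub>R z] ! i)"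
  define h :: "nat \<Rightarrow> 'a" where "h = (\<lambda>i. [0, w, b, c, e *\<^sub>R d0, e *\<^sub>R l, - e *\<^sub>R k, - (e / q0) *\<^sub>R z] ! i)"
  have f: "f 1 = w" "f 2 = b" "f 3 = c" "f 4 = - (e * q0) *\<^sub>R d0" "f 5 = (e * q2) *\<^sub>R l"
    "f 6 = - (e * q1) *\<^sub>R k" "f 7 = - (e * q0) *\<^sub>R z"
    by (simp_all add: f_def)
  have h: "h 1 = w" "h 2 = b" "h 3 = c" "h 4 = e *\<^sub>R d0" "h 5 = e *\<^sub>R l" "h 6 = - e *\<^sub>R k" "h 7 = - (e / q0) *\<^sub>R z"
    by (simp_all add: h_def)
  note tab = form_simps gA gt gz gE gk gd
  have "\<forall>i\<in>{1..7}. \<forall>j\<in>{1..7}. g (f i) (h j) = (if i = j then 1 else 0)"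
    using q q0 unfolding interval_7 by (simp add: f h tab e(1) ee del: One_nat_def)
  then have dual: "g (f i) (h j) = (if i = j then 1 else 0)" if "i \<in> {1..7}" "j \<in> {1..7}" for i j
    using that by blast
  have e0: "e \<noteq> 0" using e(1) by auto
  have total: "x = 0" if x: "\<And>j. j \<in> {1..7} \<Longrightarrow> g x (h j) = 0" for x
  proof -
    have "g x (h 1) = 0" "g x (h 2) = 0" "g x (h 3) = 0" "g x (h 4) = 0" "g x (h 5) = 0" "g x (h 6) = 0" "g x (h 7) = 0"
      by (simp_all add: x)
    then have "g x w = 0" "g x b = 0" "g x c = 0" "g x d0 = 0" "g x l = 0" "g x k = 0" "g x z = 0"
      using q0 e0 by (simp_all add: h form_simps del: One_nat_def)
    then show ?thesis
      using k ak by (intro total_zero[of x k]) (auto simp: SD_iff K b_def[symmetric] w_def[symmetric] form_simps)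
  qed
  have 1: "\<forall>i\<in>{1..7}. \<forall>j\<in>{1..7}. g (f i) (f j) = met7 r q0 i j"
    using q q0 unfolding interval_7 by (simp add: f tab met7_def r power2_eq_square e(1) ee mult_ac del: One_nat_def)
  have 2: "(e * q0) *\<^sub>R (1 - r) *\<^sub>R z = (e * q1) *\<^sub>R z" "(e * q0) *\<^sub>R r *\<^sub>R z = (e * q2) *\<^sub>R z"
    "(1 - r) *\<^sub>R (e * q0) *\<^sub>R z = (e * q1) *\<^sub>R z" "r *\<^sub>R (e * q0) *\<^sub>R z = (e * q2) *\<^sub>R z"
    using r(3,4) by (simp_all add: mult.commute mult.assoc)
  have "\<forall>i\<in>{1..7}. \<forall>j\<in>{1..7}. B (f i) (f j) = br7 r f i j"
    using q q0 unfolding interval_7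
    by (simp add: f tab br7_def B N_simps J_simps Nwb Nwc Nbc Nt Nd Jt 2 del: scaleR_scaleR One_nat_def)
  then show ?thesis
    using basis_from_dual[OF dual total] 1 r(1,2) q0 by blast
qed

end

section \<open>From the Lie algebra to the reduced data\<close>

lemma (in nilpotent_metric_lie_algebra) ric_linear: "linear (ric B g u)"
  unfolding linear_iff ric_def trace_map_def curv_def
  by (simp add: LC_simps inner_add_left inner_diff_left sum.distrib[symmetric] sum_distrib_left algebra_simps)

lemma lcs_numerals: "lcs B 2 = span {B x y | x y. y \<in> lcs B 1}" "lcs B 3 = span {B x y | x y. y \<in> lcs B 2}"
  "lcs B 1 = span {B x y | x y. y \<in> UNIV}"
  by (simp_all add: numeral_eq_Suc)

locale central_lie_algebra =
  fixes B :: "'a::euclidean_space \<Rightarrow> 'a \<Rightarrow> 'a" and g :: "'a \<Rightarrow> 'a \<Rightarrow> real"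
  assumes lie: "lie_algebra B" and nil: "three_step_nilpotent B" and dim_center: "dim (center B) = 1"
    and lor: "lorentzian g" and nondeg: "nondeg_subspace g (center B)"
begin

sublocale lorentzian_form g by (rule lorentzian_frame(2)[OF lor])

lemma B_bilin: "bilinear B" and B_self: "B x x = 0"
  using lie by (auto simp: lie_algebra_def)

lemma B_linear: "linear (B x)" "linear (\<lambda>x. B x y)"
  using B_bilin by (auto simp: bilinear_def)

lemma lcs_mem: "B x y \<in> lcs B 1" "y \<in> lcs B 1 \<Longrightarrow> B x y \<in> lcs B 2" "y \<in> lcs B 2 \<Longrightarrow> B x y = 0"
proof -
  show "B x y \<in> lcs B 1" "y \<in> lcs B 1 \<Longrightarrow> B x y \<in> lcs B 2"
    unfolding lcs_numerals by (blast intro: span_base)+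
  have "y \<in> lcs B 2 \<Longrightarrow> B x y \<in> lcs B 3"
    unfolding lcs_numerals(2) by (blast intro: span_base)
  then show "y \<in> lcs B 2 \<Longrightarrow> B x y = 0" using nil by (auto simp: three_step_nilpotent_def)
qed

lemma lcs_subspace: "subspace (lcs B 1)" "subspace (lcs B 2)" and lcs_mono: "lcs B 2 \<subseteq> lcs B 1"
proof -
  show "subspace (lcs B 1)" "subspace (lcs B 2)"
    by (simp_all add: lcs_numerals(1,3) subspace_span)
  show "lcs B 2 \<subseteq> lcs B 1"
    unfolding lcs_numerals(1,3) by (rule span_mono) blast
qed

text \<open>Every \<open>B x\<close> moves the lower central series one step down, so the traces of
  \<open>B x\<close> and of products of two such maps vanish.\<close>

lemma metric_lie: "orth_frame g UNIV S \<Longrightarrow> nilpotent_metric_lie_algebra g B S"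
proof -
  assume S: "orth_frame g UNIV S"
  have 1: "trace_map (B x) = 0" for x
    by (rule trace_map_flag_zero[OF B_linear(1) lcs_subspace lcs_mono]) (rule lcs_mem; assumption?)+
  have 2: "trace_map (\<lambda>z. B x (B y z)) = 0" for x y
  proof (rule trace_map_flag_zero[OF _ lcs_subspace lcs_mono])
    show "linear (\<lambda>z. B x (B y z))"
      using linear_compose[OF B_linear(1) B_linear(1)] by (simp add: o_def)
    show "B x (B y w) = 0" if "w \<in> lcs B 2" for w
      using lcs_mem(3)[OF that] linear_0[OF B_linear(1)] by simp
  qed (use lcs_mem(1,2) in blast)+
  show ?thesis by unfold_locales (rule lie S 1 2)+
qed

lemma frame_exists: "\<exists>S. orth_frame g UNIV S"
  by (rule lorentzian_frame(1)[OF lor])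

lemma B_anti: "B x y = - B y x"
proof -
  obtain S where "orth_frame g UNIV S" using frame_exists by blast
  then interpret nilpotent_metric_lie_algebra g B S by (rule metric_lie)
  show ?thesis by (rule B_anti)
qed

lemmas B_simps = bilinear_ladd[OF B_bilin] bilinear_radd[OF B_bilin] bilinear_lmul[OF B_bilin]
  bilinear_rmul[OF B_bilin] bilinear_lneg[OF B_bilin] bilinear_rneg[OF B_bilin]
  bilinear_lsub[OF B_bilin] bilinear_rsub[OF B_bilin] bilinear_lzero[OF B_bilin] bilinear_rzero[OF B_bilin]

lemma jacobi: "B x (B y z) + B y (B z x) + B z (B x y) = 0"
  using lie by (auto simp: lie_algebra_def)

lemma Ric_form: "g (Ric B g u) v = ric B g u v"
proof -
  obtain S where S: "orth_frame g UNIV S" using frame_exists by blast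
  then interpret nilpotent_metric_lie_algebra g B S by (rule metric_lie)
  show ?thesis unfolding Ric_def by (rule frame_THE[OF S ric_linear])
qed

lemma einstein_ric: "einstein B g \<Longrightarrow> \<exists>lam. \<forall>u v. ric B g u v = lam * g u v"
proof -
  assume "einstein B g"
  then obtain lam where "\<And>u. Ric B g u = lam *\<^sub>R u" by (auto simp: einstein_def)
  then have "ric B g u v = lam * g u v" for u v
    using Ric_form[of u v] by (simp add: form_simps)
  then show ?thesis by blast
qed

lemma ricci_flat_einstein: "ricci_flat B g \<Longrightarrow> einstein B g"
proof -
  assume "ricci_flat B g"
  then have 0: "g (Ric B g u) v = 0" for u v by (simp add: Ric_form ricci_flat_def)
  obtain S where "orth_frame g UNIV S" using frame_exists by blast
  then have "Ric B g u = 0" for u by (rule frame_ext) (simp add: 0 form_simps)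
  then show ?thesis unfolding einstein_def by (intro exI[of _ 0]) simp
qed

text \<open>A null generator would be orthogonal to the whole line, against nondegeneracy; a
  generator with nonzero norm can be rescaled.\<close>

lemma center_generator:
  obtains z where "center B = range (\<lambda>c. c *\<^sub>R z)" "g z z = 1 \<or> g z z = - 1"
proof -
  have sub: "subspace (center B)" by (auto simp: center_def subspace_def B_simps)
  obtain T where T: "T \<subseteq> center B" "independent T" "center B \<subseteq> span T" "card T = 1"
    using basis_exists[of "center B"] dim_center by metis
  then obtain z0 where z0: "T = {z0}" using card_1_singletonE by blast
  have c: "center B = range (\<lambda>c. c *\<^sub>R z0)"
    using T z0 sub span_minimal[of T "center B"] by (auto simp: span_singleton)
  have n: "g z0 z0 \<noteq> 0"
  proof
    assume "g z0 z0 = 0"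
    then have "\<forall>w\<in>center B. g z0 w = 0" by (auto simp: c form_simps)
    then have "z0 = 0" using nondeg T(1) z0 by (auto simp: nondeg_subspace_def)
    then show False using T(2) z0 dependent_zero by blast
  qed
  define m where "m = 1 / sqrt \<bar>g z0 z0\<bar>"
  have m: "m \<noteq> 0" "m * m = 1 / \<bar>g z0 z0\<bar>" using n by (simp_all add: m_def)
  have "range (\<lambda>c. c *\<^sub>R z0) = range (\<lambda>c. c *\<^sub>R (m *\<^sub>R z0))"
  proof (intro set_eqI iffI; elim rangeE)
    fix x c assume "x = c *\<^sub>R z0"
    then have "x = (c / m) *\<^sub>R (m *\<^sub>R z0)" using m(1) by simp
    then show "x \<in> range (\<lambda>c. c *\<^sub>R (m *\<^sub>R z0))" by blast
  qed auto
  moreover have "g (m *\<^sub>R z0) (m *\<^sub>R z0) = (m * m) * g z0 z0" by (simp add: form_simps)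
  then have "g (m *\<^sub>R z0) (m *\<^sub>R z0) = 1 \<or> g (m *\<^sub>R z0) (m *\<^sub>R z0) = - 1"
    unfolding m(2) using n by (cases "0 < g z0 z0") auto
  ultimately show thesis using that c by metis
qed

lemma einstein_reduction_exists:
  assumes ric: "\<And>u v. ric B g u v = lam * g u v"
  shows "\<exists>z N J. einstein_reduction g z N J 1 lam \<and> (\<forall>x y. B x y = N x y + g (J x) y *\<^sub>R z)"
proof -
  obtain z where z: "center B = range (\<lambda>c. c *\<^sub>R z)" "g z z = 1 \<or> g z z = - 1"
    by (rule center_generator)
  define \<zeta> where "\<zeta> = g z z"
  have zz: "\<zeta> * \<zeta> = 1" "\<zeta> * (\<zeta> * r) = r" for r using z(2) by (auto simp: \<zeta>_def)
  have Bz: "B z x = 0" "B x z = 0" for x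
  proof -
    have "z \<in> center B" unfolding z(1) by (rule range_eqI[of _ _ 1]) simp
    then show "B z x = 0" by (simp add: center_def)
    then show "B x z = 0" using B_anti[of x z] by simp
  qed
  have lcs2: "x \<in> center B" if "x \<in> lcs B 2" for x
    using lcs_mem(3)[OF that] B_anti[of x] by (simp add: center_def)
  have BB: "\<exists>c. B x (B y w) = c *\<^sub>R z" for x y w
    using lcs2[OF lcs_mem(2)[OF lcs_mem(1)], of x y w] by (auto simp: z(1))
  obtain S0 where S0: "orth_frame g UNIV S0" using frame_exists by blast
  define J where "J = (\<lambda>x. \<Sum>b\<in>S0. (g (B x b) z / g b b) *\<^sub>R b)"
  have J: "g (J x) y = g (B x y) z" for x y
  proof -
    have "linear (\<lambda>y. g (B x y) z)" by (simp add: linear_iff B_simps form_simps)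
    from frame_riesz[OF S0 this] show ?thesis by (simp add: J_def)
  qed
  have ext: "x = y" if "\<And>w. g x w = g y w" for x y using frame_ext[OF S0 that] .
  \<comment> \<open>As \<open>\<zeta>\<close> is its own inverse, this is the orthogonal projection
    of the bracket to the complement of \<open>z\<close>.\<close>
  define N where "N = (\<lambda>x y. B x y - (\<zeta> * g (B x y) z) *\<^sub>R z)"
  have B: "B x y = N x y + (\<zeta> * g (J x) y) *\<^sub>R z" for x y by (simp add: N_def J)
  have Nz: "N x z = 0" "N z x = 0" for x by (simp_all add: N_def Bz form_simps)
  have NV: "g (N x y) z = 0" for x y by (simp add: N_def form_simps \<zeta>_def[symmetric] mult_ac zz)
  have zN: "g z (N x y) = 0" for x y using NV sym by metis
  have BN: "B (N x y) w = B (B x y) w" "B w (N x y) = B w (B x y)" for x y w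
    by (simp_all add: N_def B_simps Bz)
  have JV: "g (J x) z = 0" for x by (simp add: J Bz form_simps)
  have N_bilin: "bilinear N"
    by (simp add: bilinear_def linear_iff N_def B_simps form_simps algebra_simps)
  have J_skew: "g (J x) y = - g x (J y)" for x y
  proof -
    have "g x (J y) = g (B y x) z" using sym[of x "J y"] J by simp
    then show ?thesis using J B_anti[of x y] by (simp add: form_simps)
  qed
  \<comment> \<open>Double brackets lie in \<open>lcs B 2\<close>, hence on the central line of
    \<open>z\<close>, which the projection kills.\<close>
  have NN: "N (N x y) w = 0" for x y w
  proof -
    obtain c where c: "B w (B x y) = c *\<^sub>R z" using BB by blast
    have "B (N x y) w = (- c) *\<^sub>R z" using B_anti[of "B x y" w] by (simp add: BN c)
    then show ?thesis by (simp add: N_def form_simps \<zeta>_def[symmetric] mult_ac zz)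
  qed
  have insert_frame: "orth_frame g UNIV (insert z S)" "z \<notin> S" if S: "orth_frame g {x. g x z = 0} S" for S
    using orth_frame_insert[of z UNIV S] S z(2) by auto
  have B_form: "g (B u b) (B v c) = g (N u b) (N v c) + \<zeta> * (g (J u) b * g (J v) c)" for u b v c
    by (simp add: B form_simps NV zN \<zeta>_def[symmetric]) (simp add: mult.assoc mult.left_commute zz)
  have einstein_V: "- 1/2 * (\<Sum>b\<in>S. g (N u b) (N v b) / g b b) - \<zeta>/2 * g (J u) (J v)
      + 1/4 * (\<Sum>b\<in>S. \<Sum>c\<in>S. g (N b c) u * g (N b c) v / (g b b * g c c)) = lam * g u v"
    if S: "orth_frame g {x. g x z = 0} S" and u: "g u z = 0" "g v z = 0" for S u v
  proof -
    interpret n: nilpotent_metric_lie_algebra g B "insert z S" by (rule metric_lie[OF insert_frame(1)[OF S]])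
    have fin: "finite S" using S by (simp add: orth_frame_def)
    have "g (J u) (J v) = (\<Sum>b\<in>S. g (J u) b * g (J v) b / g b b)"
      by (rule frame_form[OF S]) (simp add: JV)
    then have 1: "(\<Sum>b\<in>S. g (B u b) (B v b) / g b b) = (\<Sum>b\<in>S. g (N u b) (N v b) / g b b) + \<zeta> * g (J u) (J v)"
      by (simp add: B_form add_divide_distrib sum.distrib sum_distrib_left)
    have "g z u = 0" "g z v = 0" using u sym by metis+
    then have 2: "g (B b c) u = g (N b c) u" "g (B b c) v = g (N b c) v" for b c
      by (simp_all add: B form_simps)
    show ?thesis
      using n.ric_formula[of u v] ric[of u v] fin insert_frame(2)[OF S]
      by (simp add: Bz Nz form_simps 1 2 field_simps)
  qed
  have einstein_z: "(\<Sum>b\<in>S. g (J b) (J b) / g b b) = 4 * lam * \<zeta>" if S: "orth_frame g {x. g x z = 0} S" for S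
  proof -
    interpret n: nilpotent_metric_lie_algebra g B "insert z S" by (rule metric_lie[OF insert_frame(1)[OF S]])
    have fin: "finite S" using S by (simp add: orth_frame_def)
    have "g (J b) (J b) / g b b = (\<Sum>c\<in>S. g (B b c) z * g (B b c) z / (g b b * g c c))" for b
      by (subst frame_form[OF S]) (simp_all add: JV J Bz form_simps sum_divide_distrib mult.commute)
    then show ?thesis
      using n.ric_formula[of z z] ric[of z z] fin insert_frame(2)[OF S]
      by (simp add: Bz form_simps \<zeta>_def)
  qed
  \<comment> \<open>If \<open>N\<close> vanished, every bracket would be central and
    \<open>lcs B 2\<close> would be zero.\<close>
  have nontrivial: "\<exists>x y. N x y \<noteq> 0"
  proof (rule ccontr)
    assume "\<not> ?thesis"
    then have "B w (B x y) = 0" for w x y using BN(2)[of w x y] by (simp add: B_simps)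
    then have c: "B (B x y) w = 0" for w x y using B_anti[of "B x y" w] by simp
    have "subspace (center B)" by (auto simp: center_def subspace_def B_simps)
    then have "lcs B 1 \<subseteq> center B" unfolding lcs_numerals
      using c by (intro span_minimal) (auto simp: center_def)
    then have "B x y = 0" if "y \<in> lcs B 1" for x y
      using that B_anti[of x y] by (auto simp: center_def)
    then have "{B x y | x y. y \<in> lcs B 1} \<subseteq> {0}" by blast
    then have "lcs B 2 \<subseteq> {0}" unfolding lcs_numerals(1)
      by (rule span_minimal) simp
    then show False using nil subspace_0[OF lcs_subspace(2)] by (auto simp: three_step_nilpotent_def)
  qed
  have "einstein_reduction g z N J \<zeta> lam"
  proof (rule einstein_reduction.intro[OF lorentzian_form_axioms einstein_reduction_axioms.intro])
    show "g z z = \<zeta>" "\<zeta> = 1 \<or> \<zeta> = - 1" using z(2) by (auto simp: \<zeta>_def)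
    show "N x x = 0" for x by (simp add: N_def B_self form_simps)
    show "linear J"
      unfolding linear_iff by (intro conjI allI ext) (simp_all add: J form_simps B_simps)
    show "J z = 0" by (rule ext) (simp add: J Bz form_simps)
    show "g (J (N x y)) w + g (J (N y w)) x + g (J (N w x)) y = 0" for x y w
    proof -
      have "g (B x (B y w) + B y (B w x) + B w (B x y)) z = 0" using jacobi[of x y w] by (simp add: form_simps)
      then show ?thesis using B_anti[of "B x y" w] B_anti[of "B y w" x] B_anti[of "B w x" y]
        by (simp add: J BN form_simps)
    qed
    show "x = 0" if "g x z = 0" "\<And>y. N x y = 0" "J x = 0" for x
    proof -
      have "x \<in> center B" using that by (simp add: center_def B form_simps)
      then show ?thesis using that(1) z by (auto simp: form_simps)
    qed
  qed (rule N_bilin NV Nz J_skew NN nontrivial einstein_V einstein_z; assumption?)+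
  then interpret r: einstein_reduction g z N J \<zeta> lam .
  show ?thesis using r.einstein_reduction_axioms B r.zeta_one
    by (intro exI[of _ z] exI[of _ N] exI[of _ J]) simp
qed

lemma einstein_classification:
  assumes "einstein B g"
  shows "ricci_flat B g \<and>
    ((DIM('a) = 6 \<and>
       (\<exists>(f::nat \<Rightarrow> 'a) (\<alpha>::real). \<alpha> \<noteq> 0 \<and> is_basis_n 6 f \<and>
          (\<forall>i\<in>{1..6}. \<forall>j\<in>{1..6}. B (f i) (f j) = br6 f i j \<and> g (f i) (f j) = met6 \<alpha> i j)))
     \<or> (DIM('a) = 7 \<and>
       (\<exists>(f::nat \<Rightarrow> 'a) (r::real) (a::real). 0 < r \<and> r < 1 \<and> 0 < a \<and> is_basis_n 7 f \<and>
          (\<forall>i\<in>{1..7}. \<forall>j\<in>{1..7}. B (f i) (f j) = br7 r f i j \<and> g (f i) (f j) = met7 r a i j))))"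
proof -
  obtain lam where ric: "\<And>u v. ric B g u v = lam * g u v" using einstein_ric[OF assms] by blast
  obtain z N J where r: "einstein_reduction g z N J 1 lam" and B: "\<And>x y. B x y = N x y + g (J x) y *\<^sub>R z"
    using einstein_reduction_exists[OF ric] by blast
  from einstein_reduction.adapted_frame_exists[OF r] obtain SD SE d0 where
    "adapted_frame g z N J 1 lam SD SE d0" by blast
  then interpret adapted_frame g z N J 1 lam SD SE d0 .
  have "ricci_flat B g" by (simp add: ricci_flat_def ric lam_zero)
  moreover from K_cases show ?thesis
  proof (elim disjE exE conjE)
    fix k assume "K = {k}"
    from basis_6[OF this B] \<open>ricci_flat B g\<close> show ?thesis by blast
  next
    fix k l assume "k \<noteq> l" "K = {k, l}"
    from basis_7[OF this(2,1) B] \<open>ricci_flat B g\<close> show ?thesis by blast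
  qed
qed

end

theorem mainTheorem1:
  fixes B :: "'a::euclidean_space \<Rightarrow> 'a \<Rightarrow> 'a" and g :: "'a \<Rightarrow> 'a \<Rightarrow> real"
  assumes "lie_algebra B"
    and "three_step_nilpotent B"
    and "dim (center B) = 1"
    and "lorentzian g"
    and "nondeg_subspace g (center B)"
  shows "einstein B g \<longleftrightarrow>
    ricci_flat B g \<and>
    ((DIM('a) = 6 \<and>
       (\<exists>(f::nat \<Rightarrow> 'a) (\<alpha>::real). \<alpha> \<noteq> 0 \<and> is_basis_n 6 f \<and>
          (\<forall>i\<in>{1..6}. \<forall>j\<in>{1..6}. B (f i) (f j) = br6 f i j \<and> g (f i) (f j) = met6 \<alpha> i j)))
     \<or> (DIM('a) = 7 \<and>
       (\<exists>(f::nat \<Rightarrow> 'a) (r::real) (a::real). 0 < r \<and> r < 1 \<and> 0 < a \<and> is_basis_n 7 f \<and>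
          (\<forall>i\<in>{1..7}. \<forall>j\<in>{1..7}. B (f i) (f j) = br7 r f i j \<and> g (f i) (f j) = met7 r a i j))))"
proof -
  interpret central_lie_algebra B g by unfold_locales (fact assms)+
  show ?thesis using einstein_classification ricci_flat_einstein by blast
qed

end
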